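(* Let $K$ be a non-archimedean local field with discrete valuation $v$, and let $p$ be the characteristic of its residue field. Let $G=\langle A,B\rangle$ be a discrete, non-elementary subgroup of $\mathrm{SL}_2(K)$. If $K=\mathbb{Q}_p$, or $G$ contains no elements of order $p$, then $$\min\{v(\mathrm{tr}^2(A)-4),\ v(\mathrm{tr}([A,B])-2)\}\le 0.$$ Moreover, equality holds if and only if $A$ is elliptic of finite order, $B$ is hyperbolic, and the fixed point set of $A$ in $T_K$ intersects the translation axis of $B$ in a finite path whose length equals the translation length of $B$.
   Context: A non-archimedean local field is a finite extension of $\mathbb{Q}_p$ or $\mathbb{F}_q((t))$. $T_K$ is the Bruhat–Tits tree of $\mathrm{SL}_2(K)$ (edges of length 1), on which $\mathrm{SL}_2(K)$ acts by isometries without inversions; each element is elliptic (fixes a vertex) or hyperbolic (translates along a bi-infinite geodesic, its axis, by its translation length $>0$). $\mathrm{SL}_2(K)$ has the subspace topology from $K^4$. A subgroup is elementary if it stabilises a vertex, an end, or a pair of ends of $T_K$, and non-elementary otherwise. $[A,B]=ABA^{-1}B^{-1}$. *)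

theory Defs
  imports "HOL-Analysis.Analysis"
begin

text \<open>A field K (type 'k) with a normalised discrete valuation v : K^* -> Z
  (the value of v at 0 is irrelevant; v(0) = \<infinity> is handled by vinf).\<close>

definition discrete_valuation :: "('k::field \<Rightarrow> int) \<Rightarrow> bool" where
  "discrete_valuation v \<longleftrightarrow>
     (\<forall>x y. x \<noteq> 0 \<longrightarrow> y \<noteq> 0 \<longrightarrow> v (x * y) = v x + v y) \<and>
     (\<forall>x y. x \<noteq> 0 \<longrightarrow> y \<noteq> 0 \<longrightarrow> x + y \<noteq> 0 \<longrightarrow> v (x + y) \<ge> min (v x) (v y)) \<and>
     (\<exists>\<pi>. \<pi> \<noteq> 0 \<and> v \<pi> = 1)"

definition vinf :: "('k::field \<Rightarrow> int) \<Rightarrow> 'k \<Rightarrow> ereal" where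
  "vinf v x = (if x = 0 then \<infinity> else ereal (of_int (v x)))"

definition vge :: "('k::field \<Rightarrow> int) \<Rightarrow> 'k \<Rightarrow> int \<Rightarrow> bool" where
  "vge v x n \<longleftrightarrow> x = 0 \<or> v x \<ge> n"

definition val_ring :: "('k::field \<Rightarrow> int) \<Rightarrow> 'k set" where
  "val_ring v = {x. vge v x 0}"

definition res_rel :: "('k::field \<Rightarrow> int) \<Rightarrow> ('k \<times> 'k) set" where
  "res_rel v = {(x, y). x \<in> val_ring v \<and> y \<in> val_ring v \<and> vge v (x - y) 1}"

definition residue_field :: "('k::field \<Rightarrow> int) \<Rightarrow> 'k set set" where
  "residue_field v = val_ring v // res_rel v"

definition val_cauchy :: "('k::field \<Rightarrow> int) \<Rightarrow> (nat \<Rightarrow> 'k) \<Rightarrow> bool" where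
  "val_cauchy v s \<longleftrightarrow> (\<forall>N::int. \<exists>M. \<forall>m\<ge>M. \<forall>n\<ge>M. vge v (s m - s n) N)"

definition val_converges :: "('k::field \<Rightarrow> int) \<Rightarrow> (nat \<Rightarrow> 'k) \<Rightarrow> bool" where
  "val_converges v s \<longleftrightarrow> (\<exists>l. \<forall>N::int. \<exists>M. \<forall>n\<ge>M. vge v (s n - l) N)"

definition nonarch_local_field :: "('k::field \<Rightarrow> int) \<Rightarrow> bool" where
  "nonarch_local_field v \<longleftrightarrow>
     discrete_valuation v \<and>
     (\<forall>s. val_cauchy v s \<longrightarrow> val_converges v s) \<and>
     finite (residue_field v)"

definition residue_char :: "('k::field \<Rightarrow> int) \<Rightarrow> nat \<Rightarrow> bool" where
  "residue_char v p \<longleftrightarrow> prime p \<and> vge v (of_nat p) 1"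

text \<open>K is (isomorphic, as a valued field, to) Q_p: characteristic 0, unramified (v(p) = 1)
  and residue field with p elements, i.e. [K : Q_p] = e f = 1.\<close>
definition is_Qp :: "('k::field \<Rightarrow> int) \<Rightarrow> nat \<Rightarrow> bool" where
  "is_Qp v p \<longleftrightarrow> (\<forall>n::nat. n > 0 \<longrightarrow> (of_nat n :: 'k) \<noteq> 0) \<and>
                  of_nat p \<noteq> (0::'k) \<and> v (of_nat p) = 1 \<and> card (residue_field v) = p"

type_synonym 'k mat2 = "'k^2^2"

definition SL2 :: "'k::field mat2 set" where
  "SL2 = {M. det M = 1}"

definition tr2 :: "'k::field mat2 \<Rightarrow> 'k" where
  "tr2 M = M$1$1 + M$2$2"

definition comm2 :: "'k::field mat2 \<Rightarrow> 'k mat2 \<Rightarrow> 'k mat2" where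
  "comm2 A B = A ** B ** matrix_inv A ** matrix_inv B"

definition mpow :: "'k::field mat2 \<Rightarrow> nat \<Rightarrow> 'k mat2" where
  "mpow g n = ((\<lambda>M. g ** M) ^^ n) (mat 1)"

definition has_finite_order :: "'k::field mat2 \<Rightarrow> bool" where
  "has_finite_order g \<longleftrightarrow> (\<exists>n>0. mpow g n = mat 1)"

definition has_order :: "'k::field mat2 \<Rightarrow> nat \<Rightarrow> bool" where
  "has_order g n \<longleftrightarrow> n > 0 \<and> mpow g n = mat 1 \<and> (\<forall>m. 0 < m \<and> m < n \<longrightarrow> mpow g m \<noteq> mat 1)"

inductive_set gen2 :: "'k::field mat2 \<Rightarrow> 'k mat2 \<Rightarrow> 'k mat2 set" for A B where
  gen_one: "mat 1 \<in> gen2 A B"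
| gen_A: "A \<in> gen2 A B"
| gen_B: "B \<in> gen2 A B"
| gen_mult: "g \<in> gen2 A B \<Longrightarrow> h \<in> gen2 A B \<Longrightarrow> g ** h \<in> gen2 A B"
| gen_inv: "g \<in> gen2 A B \<Longrightarrow> matrix_inv g \<in> gen2 A B"

definition discrete_subgroup :: "('k::field \<Rightarrow> int) \<Rightarrow> 'k mat2 set \<Rightarrow> bool" where
  "discrete_subgroup v G \<longleftrightarrow>
     (\<forall>g\<in>G. \<exists>N::int. \<forall>h\<in>G. (\<forall>i j. vge v (h$i$j - g$i$j) N) \<longrightarrow> h = g)"

definition lat :: "('k::field \<Rightarrow> int) \<Rightarrow> 'k mat2 \<Rightarrow> ('k^2) set" where
  "lat v g = {g *v x | x. \<forall>i. vge v (x$i) 0}"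

definition vtx :: "('k::field \<Rightarrow> int) \<Rightarrow> 'k mat2 \<Rightarrow> ('k^2) set set" where
  "vtx v g = {(\<lambda>x. c *s x) ` lat v g | c. c \<noteq> 0}"

definition bt_verts :: "('k::field \<Rightarrow> int) \<Rightarrow> ('k^2) set set set" where
  "bt_verts v = {vtx v g | g. det g \<noteq> 0}"

text \<open>Distance between [g O^2] and [h O^2]: with M = g^-1 h having elementary divisors
  pi^a, pi^b (a \<le> b), it is b - a = v(det M) - 2 min_{ij} v(M_ij).\<close>
definition mat_dist :: "('k::field \<Rightarrow> int) \<Rightarrow> 'k mat2 \<Rightarrow> 'k mat2 \<Rightarrow> nat" where
  "mat_dist v g h = (let M = matrix_inv g ** h in
      nat (v (det M) - 2 * Min {v (M$i$j) | i j. M$i$j \<noteq> 0}))"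

definition bt_dist :: "('k::field \<Rightarrow> int) \<Rightarrow> ('k^2) set set \<Rightarrow> ('k^2) set set \<Rightarrow> nat" where
  "bt_dist v X Y = mat_dist v (SOME g. det g \<noteq> 0 \<and> X = vtx v g) (SOME h. det h \<noteq> 0 \<and> Y = vtx v h)"

definition bt_act :: "'k::field mat2 \<Rightarrow> ('k^2) set set \<Rightarrow> ('k^2) set set" where
  "bt_act A X = (\<lambda>L. (\<lambda>x. A *v x) ` L) ` X"

definition fix_set :: "('k::field \<Rightarrow> int) \<Rightarrow> 'k mat2 \<Rightarrow> ('k^2) set set set" where
  "fix_set v A = {X \<in> bt_verts v. bt_act A X = X}"

definition elliptic :: "('k::field \<Rightarrow> int) \<Rightarrow> 'k mat2 \<Rightarrow> bool" where
  "elliptic v A \<longleftrightarrow> fix_set v A \<noteq> {}"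

definition trans_len :: "('k::field \<Rightarrow> int) \<Rightarrow> 'k mat2 \<Rightarrow> nat" where
  "trans_len v A = (LEAST n. \<exists>X\<in>bt_verts v. bt_dist v X (bt_act A X) = n)"

definition hyperbolic :: "('k::field \<Rightarrow> int) \<Rightarrow> 'k mat2 \<Rightarrow> bool" where
  "hyperbolic v A \<longleftrightarrow> trans_len v A > 0"

definition axis :: "('k::field \<Rightarrow> int) \<Rightarrow> 'k mat2 \<Rightarrow> ('k^2) set set set" where
  "axis v A = {X \<in> bt_verts v. bt_dist v X (bt_act A X) = trans_len v A}"

definition ray :: "('k::field \<Rightarrow> int) \<Rightarrow> (nat \<Rightarrow> ('k^2) set set) \<Rightarrow> bool" where
  "ray v r \<longleftrightarrow> (\<forall>n. r n \<in> bt_verts v) \<and> (\<forall>m n. bt_dist v (r m) (r n) = nat \<bar>int m - int n\<bar>)"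

definition same_end :: "(nat \<Rightarrow> ('k^2) set set) \<Rightarrow> (nat \<Rightarrow> ('k^2) set set) \<Rightarrow> bool" where
  "same_end r s \<longleftrightarrow> (\<exists>i j. \<forall>n. r (i + n) = s (j + n))"

definition elementary :: "('k::field \<Rightarrow> int) \<Rightarrow> 'k mat2 set \<Rightarrow> bool" where
  "elementary v G \<longleftrightarrow>
     (\<exists>X\<in>bt_verts v. \<forall>g\<in>G. bt_act g X = X) \<or>
     (\<exists>r. ray v r \<and> (\<forall>g\<in>G. same_end (bt_act g \<circ> r) r)) \<or>
     (\<exists>r s. ray v r \<and> ray v s \<and> \<not> same_end r s \<and>
        (\<forall>g\<in>G. (same_end (bt_act g \<circ> r) r \<and> same_end (bt_act g \<circ> s) s) \<or>
                (same_end (bt_act g \<circ> r) s \<and> same_end (bt_act g \<circ> s) r)))"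

end

theory Submission
  imports Defs
begin

text \<open>
  Put \<open>t = tr A\<close>, \<open>f(x) = x\<^sup>2 - t x + 1\<close> and \<open>\<gamma> = tr [A,B] - 2 = - det (AB - BA)\<close>. If \<open>v t < 0\<close>, then \<open>A\<close> is
  hyperbolic and \<open>v (t\<^sup>2 - 4) < 0\<close>. Otherwise there are three cases.

  If \<open>f\<close> has no root modulo \<open>\<pi>\<^sup>2\<close>, then in a basis in which \<open>A\<close> is the companion matrix of \<open>f\<close>, \<open>\<gamma>\<close> is a value of
  the norm form of \<open>f\<close>, and integrality of \<open>\<gamma>\<close> forces \<open>A\<close> and \<open>B\<close> to fix a common vertex. So \<open>v \<gamma> < 0\<close>.
  On the other hand \<open>A\<close> does not fix two vertices at distance at least 2, whereas translation lengths
  are even.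

  If \<open>f\<close> has a root modulo \<open>\<pi>\<^sup>2\<close> and \<open>v (t\<^sup>2 - 4) > 0\<close>, then \<open>A\<^sup>2\<close> is unipotent modulo \<open>\<pi>\<close>, hence has \<open>p\<close>-power
  order by discreteness. If there is no \<open>p\<close>-torsion, then \<open>A = \<plusminus>1\<close>. For \<open>\<rat>\<^sub>p\<close> there is none when \<open>p \<ge> 5\<close>, and
  when \<open>p \<le> 3\<close> the trace of \<open>A\<close> is so restricted that \<open>f\<close> has no root modulo \<open>\<pi>\<^sup>2\<close>.

  If \<open>f\<close> has a root modulo \<open>\<pi>\<^sup>2\<close> and \<open>v (t\<^sup>2 - 4) = 0\<close>, then \<open>A = diag(l, m)\<close> by Hensel's lemma, \<open>Fix A\<close> is the
  line of the vertices \<open>[\<langle>e\<^sub>1, \<pi>\<^sup>n e\<^sub>2\<rangle>]\<close>, and \<open>v \<gamma> = v (b c)\<close> for \<open>B = (a, b; c, d)\<close>. If the axis of \<open>B\<close> meets this line, it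
  does so in a path of length \<open>v (b c)\<close> plus the translation length. Finally \<open>v (b c) > 0\<close> is impossible:
  then \<open>[A, BAB\<^sup>-\<^sup>1]\<close> is unipotent modulo \<open>\<pi>\<close>, hence trivial.
\<close>

section \<open>Discrete valuations\<close>

locale dval =
  fixes v :: "'k::field \<Rightarrow> int"
  assumes dv: "discrete_valuation v"
begin

lemma v_mult: "x \<noteq> 0 \<Longrightarrow> y \<noteq> 0 \<Longrightarrow> v (x * y) = v x + v y"
  using dv unfolding discrete_valuation_def by blast

lemma v_add: "x \<noteq> 0 \<Longrightarrow> y \<noteq> 0 \<Longrightarrow> x + y \<noteq> 0 \<Longrightarrow> min (v x) (v y) \<le> v (x + y)"
  using dv unfolding discrete_valuation_def by blast

lemma v_one [simp]: "v 1 = 0"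
  using v_mult[of 1 1] by simp

lemma v_uminus [simp]: "v (- x) = v x"
proof (cases "x = 0")
  case False
  have "v (-1) = 0" using v_mult[of "-1" "-1"] by simp
  then show ?thesis using v_mult[of "-1" x] False by simp
qed simp

lemma v_inverse: "x \<noteq> 0 \<Longrightarrow> v (inverse x) = - v x"
  using v_mult[of x "inverse x"] by simp

lemma v_divide: "x \<noteq> 0 \<Longrightarrow> y \<noteq> 0 \<Longrightarrow> v (x / y) = v x - v y"
  by (simp add: divide_inverse v_mult v_inverse)

lemma v_power: "x \<noteq> 0 \<Longrightarrow> v (x ^ n) = int n * v x"
  by (induction n) (auto simp: v_mult algebra_simps)

lemma v_power_int: "x \<noteq> 0 \<Longrightarrow> v (x powi n) = n * v x"
  by (cases "n \<ge> 0") (auto simp: power_int_def v_power v_inverse)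

lemma uniformizer: obtains \<pi> where "\<pi> \<noteq> 0" "v \<pi> = 1"
  using dv unfolding discrete_valuation_def by blast

lemma vge_0 [simp]: "vge v 0 n"
  by (simp add: vge_def)

lemma vge_1 [simp]: "vge v 1 0"
  by (simp add: vge_def)

lemma vge_v [simp]: "vge v x (v x)"
  by (simp add: vge_def)

lemma not_vge: "\<not> vge v x n \<longleftrightarrow> x \<noteq> 0 \<and> v x < n"
  by (auto simp: vge_def)

lemma vge_mono: "vge v x n \<Longrightarrow> m \<le> n \<Longrightarrow> vge v x m"
  by (auto simp: vge_def)

lemma vge_uminus [simp]: "vge v (- x) n \<longleftrightarrow> vge v x n"
  by (auto simp: vge_def)

lemma vge_add: "vge v x n \<Longrightarrow> vge v y n \<Longrightarrow> vge v (x + y) n"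
proof -
  assume "vge v x n" "vge v y n"
  then show ?thesis
    unfolding vge_def using v_add[of x y] by (cases "x = 0"; cases "y = 0") fastforce+
qed

lemma vge_diff: "vge v x n \<Longrightarrow> vge v y n \<Longrightarrow> vge v (x - y) n"
  using vge_add[of x n "- y"] by simp

lemma vge_mult: "vge v x m \<Longrightarrow> vge v y n \<Longrightarrow> vge v (x * y) (m + n)"
  by (cases "x = 0"; cases "y = 0") (simp_all add: vge_def v_mult)

lemma vge_mult0: "vge v x 0 \<Longrightarrow> vge v y 0 \<Longrightarrow> vge v (x * y) 0"
  using vge_mult[of x 0 y 0] by simp

lemma vge_mult_left: "vge v x 0 \<Longrightarrow> vge v y n \<Longrightarrow> vge v (x * y) n"
  using vge_mult[of x 0 y n] by simp

lemma vge_mult_right: "vge v x n \<Longrightarrow> vge v y 0 \<Longrightarrow> vge v (x * y) n"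
  using vge_mult[of x n y 0] by simp

lemma vge_power0: "vge v x 0 \<Longrightarrow> vge v (x ^ n) 0"
  by (induction n) (auto intro: vge_mult0)

lemma vge_of_nat [simp]: "vge v (of_nat n) 0"
  by (induction n) (auto intro: vge_add)

lemma vge_numeral [simp]: "vge v (numeral n) 0"
  using vge_of_nat[of "numeral n"] by simp

lemma vge_divide: "vge v x n \<Longrightarrow> y \<noteq> 0 \<Longrightarrow> vge v (x / y) (n - v y)"
  by (cases "x = 0") (simp_all add: vge_def v_divide)

lemma vge_mult_cancel: "c \<noteq> 0 \<Longrightarrow> vge v (c * x) n \<longleftrightarrow> vge v x (n - v c)"
  by (cases "x = 0") (auto simp: vge_def v_mult)

lemma vge_square: "vge v (x\<^sup>2) n \<longleftrightarrow> x = 0 \<or> n \<le> 2 * v x"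
  by (cases "x = 0") (auto simp: vge_def v_power)

lemma v_add_less:
  assumes "x \<noteq> 0" "vge v y (v x + 1)"
  shows "x + y \<noteq> 0" "v (x + y) = v x"
proof -
  have A: "\<not> vge v (x + y) (v x + 1)"
    using vge_diff[of "x + y" "v x + 1" y] assms by (auto simp: vge_def)
  then show "x + y \<noteq> 0" by auto
  have "vge v (x + y) (v x)"
    using assms by (auto intro!: vge_add intro: vge_mono)
  then show "v (x + y) = v x" using A by (auto simp: vge_def)
qed

lemma vge_all_imp_0: "(\<And>n. vge v x n) \<Longrightarrow> x = 0"
  unfolding vge_def by (metis less_add_one not_less)

lemmas vge_intros = vge_add vge_diff vge_mult0 vge_power0

end

section \<open>Two-by-two matrices\<close>

definition mk2 :: "'a \<Rightarrow> 'a \<Rightarrow> 'a \<Rightarrow> 'a \<Rightarrow> 'a::zero^2^2" where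
  "mk2 a b c d = vector [vector [a, b], vector [c, d]]"

lemma mk2_nth [simp]:
  "mk2 a b c d $ 1 $ 1 = a" "mk2 a b c d $ 1 $ 2 = b"
  "mk2 a b c d $ 2 $ 1 = c" "mk2 a b c d $ 2 $ 2 = d"
  by (simp_all add: mk2_def)

lemma mk2_eq_iff [simp]: "mk2 a b c d = mk2 a' b' c' d' \<longleftrightarrow> a = a' \<and> b = b' \<and> c = c' \<and> d = d'"
  by (metis mk2_nth)

lemma mat2_eq_iff: "(M :: 'a^2^2) = N \<longleftrightarrow> M$1$1 = N$1$1 \<and> M$1$2 = N$1$2 \<and> M$2$1 = N$2$1 \<and> M$2$2 = N$2$2"
  by (auto simp: vec_eq_iff forall_2)

lemma mk2_eta: "(M :: 'a::zero^2^2) = mk2 (M$1$1) (M$1$2) (M$2$1) (M$2$2)"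
  by (simp add: mat2_eq_iff)

lemma mat2_cases: obtains a b c d where "(M :: 'a::zero^2^2) = mk2 a b c d"
  using mk2_eta by blast

lemma mk2_mult [simp]:
  "mk2 a b c d ** mk2 e f g h = mk2 (a*e + b*g) (a*f + b*h) (c*e + d*g) (c*f + d*h :: 'a::comm_ring_1)"
  by (simp add: mat2_eq_iff matrix_matrix_mult_def sum_2)

lemma mk2_diff [simp]:
  "mk2 a b c d - mk2 e f g h = mk2 (a-e) (b-f) (c-g) (d-h :: 'a::comm_ring_1)"
  by (simp add: mat2_eq_iff)

lemma mat2_diff_distrib:
  fixes M N P :: "'a::comm_ring_1^2^2"
  shows "(M - N) ** P = M ** P - N ** P" "P ** (M - N) = P ** M - P ** N"
  by (simp_all add: mat2_eq_iff matrix_matrix_mult_def sum_2 algebra_simps)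

lemma det_mk2 [simp]: "det (mk2 a b c d :: 'a::comm_ring_1^2^2) = a * d - b * c"
  by (simp add: det_2)

lemma det2_0 [simp]: "det (0 :: 'a::comm_ring_1^2^2) = 0"
  by (simp add: det_2)

lemma mat_1_mk2: "(mat 1 :: 'a::comm_ring_1^2^2) = mk2 1 0 0 1"
  by (simp add: mat2_eq_iff mat_def)

lemma tr2_mk2 [simp]: "tr2 (mk2 a b c d) = a + d"
  by (simp add: tr2_def)

lemma matrix_inv_mult:
  fixes P :: "'a::field^'n^'n"
  assumes "det P \<noteq> 0"
  shows "P ** matrix_inv P = mat 1" "matrix_inv P ** P = mat 1"
proof -
  have "\<exists>Q. P ** Q = mat 1 \<and> Q ** P = mat 1"
    using assms by (metis invertible_det_nz invertible_def)
  then have "P ** matrix_inv P = mat 1 \<and> matrix_inv P ** P = mat 1"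
    unfolding matrix_inv_def by (rule someI_ex)
  then show "P ** matrix_inv P = mat 1" "matrix_inv P ** P = mat 1" by auto
qed

lemma matrix_inv_eqI:
  fixes P :: "'a::field^'n^'n"
  assumes "P ** Q = mat 1"
  shows "matrix_inv P = Q"
proof -
  have "det P \<noteq> 0" using assms by (metis det_I det_mul mult_zero_left zero_neq_one)
  then show ?thesis
    by (metis assms matrix_inv_mult(2) matrix_mul_assoc matrix_mul_lid matrix_mul_rid)
qed

lemma matrix_inv_mk2: "a * d - b * c = 1 \<Longrightarrow> matrix_inv (mk2 a b c d :: 'a::field^2^2) = mk2 d (-b) (-c) a"
  by (intro matrix_inv_eqI) (simp add: mat_1_mk2 algebra_simps)

text \<open>The equation \<open>M ** P = P ** N\<close> says that \<open>N\<close> is the matrix of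
  \<open>M\<close> in the basis formed by the columns of \<open>P\<close>. Base changes are kept in
  this form, so that they compose by associativity.\<close>

lemma frame_exists:
  fixes P M :: "'a::field^'n^'n"
  assumes "det P \<noteq> 0"
  obtains N where "M ** P = P ** N" "det N = det M"
proof -
  have *: "M ** P = P ** (matrix_inv P ** M ** P)"
    by (metis assms matrix_inv_mult(1) matrix_mul_assoc matrix_mul_lid)
  have "det M * det P = det P * det (matrix_inv P ** M ** P)"
    using arg_cong[OF *, of det] by (simp add: det_mul)
  then show ?thesis using * that assms by auto
qed

lemma matrix_left_cancel:
  fixes P M N :: "'a::field^'n^'n"
  assumes "det P \<noteq> 0" "P ** M = P ** N"
  shows "M = N"
  by (metis assms matrix_inv_mult(2) matrix_mul_assoc matrix_mul_lid)

lemma det_frame: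
  fixes M :: "'a::field^'n^'n"
  assumes "det P \<noteq> 0" "M ** P = P ** N"
  shows "det N = det M"
  using assms by (metis det_mul mult.commute mult_left_cancel)

lemma tr2_frame:
  fixes M :: "'a::field^2^2"
  assumes "det P \<noteq> 0" "M ** P = P ** N"
  shows "tr2 M = tr2 N"
proof -
  have tr: "tr2 (X ** Y) = tr2 (Y ** X)" for X Y :: "'a^2^2"
    by (cases X rule: mat2_cases; cases Y rule: mat2_cases) (simp add: algebra_simps)
  have "M = P ** N ** matrix_inv P"
    by (metis assms matrix_inv_mult(1) matrix_mul_assoc matrix_mul_rid)
  then show ?thesis
    by (metis tr assms(1) matrix_inv_mult(2) matrix_mul_assoc matrix_mul_lid)
qed

text \<open>For 2 by 2 matrices, det (X - Y) = det X + det Y - tr (X adj Y). Take X = AB and Y = BA,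
  whose adjugate is A^-1 B^-1.\<close>

lemma tr2_comm2:
  fixes A B :: "'a::field^2^2"
  assumes "det A = 1" "det B = 1"
  shows "tr2 (comm2 A B) - 2 = - det (A ** B - B ** A)"
proof -
  obtain a b c d where A: "A = mk2 a b c d" by (rule mat2_cases)
  obtain e f g h where B: "B = mk2 e f g h" by (rule mat2_cases)
  have 1: "a * d - b * c = 1" "e * h - f * g = 1" using assms A B by auto
  have "tr2 (comm2 A B) = 2 * (a * d - b * c) * (e * h - f * g) - det (A ** B - B ** A)"
    unfolding comm2_def A B using 1 by (simp add: matrix_inv_mk2) algebra
  then show ?thesis using 1 by simp
qed

lemma det_commutator_frame:
  fixes A B :: "'a::field^2^2"
  assumes "det P \<noteq> 0" "A ** P = P ** A'" "B ** P = P ** B'"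
  shows "det (A ** B - B ** A) = det (A' ** B' - B' ** A')"
proof -
  have "A ** B ** P = P ** (A' ** B')" "B ** A ** P = P ** (B' ** A')"
    by (metis assms(2,3) matrix_mul_assoc)+
  then have "(A ** B - B ** A) ** P = P ** (A' ** B' - B' ** A')"
    by (simp add: mat2_diff_distrib)
  then have "det (A ** B - B ** A) * det P = det P * det (A' ** B' - B' ** A')"
    by (metis det_mul)
  then show ?thesis using assms(1) by simp
qed

lemma det_commutator_diagonal:
  "det (mk2 l 0 0 m ** M - M ** mk2 l 0 0 m) = (l - m)\<^sup>2 * (M$1$2 * M$2$1 :: 'a::comm_ring_1)"
  by (cases M rule: mat2_cases) (simp add: power2_eq_square algebra_simps)

text \<open>A non-scalar matrix has a cyclic vector w, and the basis w, Aw gives the companion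
  matrix. One of e1, e2, e1 + e2 is cyclic.\<close>

lemma companion_frame:
  fixes A :: "'a::field^2^2"
  assumes "det A = 1" and ns: "\<And>x. A \<noteq> mk2 x 0 0 x"
  obtains Q where "det Q \<noteq> 0" "A ** Q = Q ** mk2 0 (-1) 1 (tr2 A)"
proof -
  obtain a b c d where A: "A = mk2 a b c d" by (rule mat2_cases)
  have 1: "a * d - b * c = 1" using assms A by auto
  \<comment> \<open>The columns are w = (x, y) and Aw; Cayley-Hamilton gives A(Aw) = (tr A) Aw -
    w.\<close>
  have cyc: "A ** mk2 x (a*x + b*y) y (c*x + d*y) = mk2 x (a*x + b*y) y (c*x + d*y) ** mk2 0 (-1) 1 (tr2 A)"
    for x y
  proof -
    have "a * (a*x + b*y) + b * (c*x + d*y) = (a + d) * (a*x+b*y) - (a*d-b*c) * x"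
      "c * (a*x + b*y) + d * (c*x + d*y) = (a + d) * (c*x+d*y) - (a*d-b*c) * y"
      by algebra+
    then show ?thesis using 1 by (simp add: A algebra_simps)
  qed
  show thesis
  proof (cases "c \<noteq> 0")
    case True then show ?thesis using that[OF _ cyc[of 1 0]] by simp
  next
    case c: False
    show ?thesis
    proof (cases "b \<noteq> 0")
      case True then show ?thesis using that[OF _ cyc[of 0 1]] by simp
    next
      case False
      then have "a \<noteq> d" using ns[of a] c by (auto simp: A)
      then show ?thesis using that[OF _ cyc[of 1 1]] c False by simp
    qed
  qed
qed

lemma eigen_companion:
  assumes "l * m = 1" "l + m = (t::'a::field)"
  shows "mk2 0 (-1) 1 t ** mk2 1 1 (-l) (-m) = mk2 1 1 (-l) (-m) ** mk2 l 0 0 m"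
proof -
  have "1 - (l + m) * l = - (l * l) + (1 - l * m)" "1 - (l + m) * m = - (m * m) + (1 - l * m)"
    by algebra+
  then show ?thesis using assms by (auto simp: algebra_simps)
qed

lemma diagonal_frame:
  fixes A :: "'a::field^2^2"
  assumes "det A = 1" "l * m = 1" "l + m = tr2 A" "l \<noteq> m"
  obtains P where "det P \<noteq> 0" "A ** P = P ** mk2 l 0 0 m"
proof -
  have "A \<noteq> mk2 x 0 0 x" for x
  proof
    assume *: "A = mk2 x 0 0 x"
    then have "x * x = l * m" "l + m = x + x" using assms by simp_all
    then have "(l - m) * (l - m) = 0" by algebra
    then show False using assms by simp
  qed
  then obtain Q where Q: "det Q \<noteq> 0" "A ** Q = Q ** mk2 0 (-1) 1 (tr2 A)"
    using companion_frame[OF assms(1)] by metis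
  have "A ** (Q ** mk2 1 1 (-l) (-m)) = Q ** mk2 1 1 (-l) (-m) ** mk2 l 0 0 m"
    unfolding matrix_mul_assoc Q(2)
    by (simp only: eigen_companion[OF assms(2,3)] matrix_mul_assoc[symmetric])
  moreover have "det (Q ** mk2 1 1 (-l) (-m)) \<noteq> 0" using Q(1) assms(4) by (simp add: det_mul)
  ultimately show thesis using that by blast
qed

lemma SL2_scalar:
  fixes x :: "'a::field"
  assumes "det (mk2 x 0 0 x) = 1"
  shows "x = 1 \<or> x = -1"
  using assms by (simp add: square_eq_1_iff)

lemma mpow_0 [simp]: "mpow g 0 = mat 1"
  and mpow_Suc: "mpow g (Suc n) = g ** mpow g n"
  by (simp_all add: mpow_def)

lemma mpow_1 [simp]: "mpow g (Suc 0) = g"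
  by (simp add: mpow_Suc)

lemma mpow_add: "mpow g (m + n) = mpow g m ** mpow g n"
  by (induction m) (simp_all add: mpow_Suc matrix_mul_assoc)

lemma mpow_mult: "mpow g (m * n) = mpow (mpow g m) n"
  by (induction n) (simp_all add: mpow_Suc mpow_add)

lemma mpow_mat_1 [simp]: "mpow (mat 1) n = mat 1"
  by (induction n) (simp_all add: mpow_Suc)

lemma mpow_frame: "A ** P = P ** A' \<Longrightarrow> mpow A n ** P = P ** mpow A' n"
  by (induction n) (simp_all add: mpow_Suc, metis matrix_mul_assoc)

lemma det_mpow: "det (mpow g n) = det g ^ n"
  by (induction n) (simp_all add: mpow_Suc det_mul)

lemma mpow_gen2: "g \<in> gen2 A B \<Longrightarrow> mpow g n \<in> gen2 A B"
  by (induction n) (auto simp: mpow_Suc intro: gen2.intros)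

lemma det_gen2:
  fixes A B :: "'a::field^2^2"
  assumes "det A = 1" "det B = 1" "g \<in> gen2 A B"
  shows "det g = 1"
  using assms(3)
proof induction
  case (gen_inv g)
  then have "det g * det (matrix_inv g) = 1"
    by (metis det_I det_mul matrix_inv_mult(1) zero_neq_one)
  with gen_inv show ?case by simp
qed (use assms in \<open>auto simp: det_mul\<close>)

section \<open>Vertices of the tree and their distances\<close>

context dval
begin

definition int2 :: "'k^2^2 \<Rightarrow> bool" where
  "int2 M \<longleftrightarrow> (\<forall>i j. vge v (M$i$j) 0)"

text \<open>For a non-singular matrix this is the valuation of the first elementary divisor. For the
  zero matrix the minimum is over the empty set, hence the assumption \<open>M \<noteq> 0\<close> in
  several facts below.\<close>

definition mval :: "'k^2^2 \<Rightarrow> int" where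
  "mval M = Min {v (M$i$j) | i j. M$i$j \<noteq> 0}"

lemma int2_mk2 [simp]: "int2 (mk2 a b c d) \<longleftrightarrow> vge v a 0 \<and> vge v b 0 \<and> vge v c 0 \<and> vge v d 0"
  by (auto simp: int2_def forall_2)

lemma int2_mult: "int2 M \<Longrightarrow> int2 N \<Longrightarrow> int2 (M ** N)"
  by (cases M rule: mat2_cases; cases N rule: mat2_cases) (auto intro: vge_intros)

lemma int2_det: "int2 M \<Longrightarrow> vge v (det M) 0"
  by (cases M rule: mat2_cases) (auto intro: vge_intros)

lemma int2_inverse:
  assumes "int2 U" "det U \<noteq> 0" "v (det U) = 0"
  obtains W where "int2 W" "U ** W = mat 1" "W ** U = mat 1" "det W \<noteq> 0" "v (det W) = 0"
proof -
  obtain a b c d where U: "U = mk2 a b c d" by (rule mat2_cases)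
  define e where "e = inverse (a*d - b*c)"
  have nz: "a*d - b*c \<noteq> 0" and v0: "v (a*d - b*c) = 0" using assms(2,3) U by auto
  have e: "e * (a*d - b*c) = 1" "e \<noteq> 0" "v e = 0" using nz v0 by (auto simp: e_def v_inverse)
  define W where "W = mk2 (e*d) (-e*b) (-e*c) (e*a)"
  have "vge v e 0" using e by (simp add: vge_def)
  then have "int2 W" using assms(1) unfolding U W_def by (auto intro: vge_mult0)
  moreover have "U ** W = mat 1" "W ** U = mat 1"
    unfolding U W_def mat_1_mk2 using e(1) by (auto simp: algebra_simps)
  moreover have "det W = e"
    using e(1) unfolding W_def by (simp add: algebra_simps) algebra
  ultimately show thesis using that e by metis
qed

lemma vge_mval_iff:
  assumes "M \<noteq> 0"
  shows "n \<le> mval M \<longleftrightarrow> (\<forall>i j. vge v (M$i$j) n)"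
proof -
  let ?S = "{v (M$i$j) | i j. M$i$j \<noteq> 0}"
  have "?S \<subseteq> (\<lambda>(i,j). v (M$i$j)) ` UNIV" by auto
  then have fin: "finite ?S" by (rule finite_subset) simp
  have ne: "?S \<noteq> {}" using assms by (auto simp: vec_eq_iff)
  show ?thesis unfolding mval_def
    using fin ne by (auto simp: vge_def)
qed

lemma mval_attained:
  assumes "M \<noteq> 0"
  obtains i j where "M$i$j \<noteq> 0" "v (M$i$j) = mval M"
proof -
  have "\<not> (\<forall>i j. vge v (M$i$j) (mval M + 1))" "\<forall>i j. vge v (M$i$j) (mval M)"
    using vge_mval_iff[OF assms, of "mval M + 1"] vge_mval_iff[OF assms, of "mval M"] by auto
  then obtain i j where "\<not> vge v (M$i$j) (mval M + 1)" "vge v (M$i$j) (mval M)" by blast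
  then show thesis using that[of i j] by (auto simp: vge_def)
qed

lemma vge_mval: "vge v (M$i$j) (mval M)"
  using vge_mval_iff[of M "mval M"] by (cases "M = 0") auto

lemma mval_eqI:
  assumes "M \<noteq> 0" "N \<noteq> 0" "\<And>n. (\<forall>i j. vge v (M$i$j) n) \<longleftrightarrow> (\<forall>i j. vge v (N$i$j) n)"
  shows "mval M = mval N"
  using assms vge_mval_iff by (metis order_antisym order_refl)

lemma vge_matrix_mult:
  fixes M N :: "'k^2^2"
  assumes "\<forall>i j. vge v (M$i$j) m" "\<forall>i j. vge v (N$i$j) n"
  shows "\<forall>i j. vge v ((M ** N)$i$j) (m + n)"
  using assms by (auto simp: matrix_matrix_mult_def sum_2 intro!: vge_add vge_mult)

lemma mval_mult_unit:
  assumes "det M \<noteq> 0" "int2 U" "det U \<noteq> 0" "v (det U) = 0" "int2 W" "det W \<noteq> 0" "v (det W) = 0"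
  shows "mval (U ** M ** W) = mval M"
proof -
  obtain U' where U': "int2 U'" "U ** U' = mat 1" "U' ** U = mat 1"
    using int2_inverse[OF assms(2-4)] by metis
  obtain W' where W': "int2 W'" "W ** W' = mat 1" "W' ** W = mat 1"
    using int2_inverse[OF assms(5-7)] by metis
  have M: "M = U' ** (U ** M ** W) ** W'"
    using U' W' by (metis matrix_mul_assoc matrix_mul_lid matrix_mul_rid)
  have imp: "\<forall>i j. vge v ((X ** Y ** Z)$i$j) n" if "int2 X" "int2 Z" "\<forall>i j. vge v (Y$i$j) n" for X Y Z n
    using vge_matrix_mult[OF vge_matrix_mult[of X 0 Y n], of Z 0] that unfolding int2_def by simp
  have "det (U ** M ** W) \<noteq> 0" using assms(1,3,6) by (simp add: det_mul)
  then have nz: "M \<noteq> 0" "U ** M ** W \<noteq> 0" using assms(1) by auto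
  show ?thesis
    using imp[OF U'(1) W'(1), of "U ** M ** W"] imp[OF assms(2,5), of M] M
    by (intro mval_eqI nz) metis
qed

lemma mat_dist_mval: "mat_dist v g h = nat (v (det (matrix_inv g ** h)) - 2 * mval (matrix_inv g ** h))"
  by (simp add: mat_dist_def mval_def Let_def)

subsection \<open>Lattices\<close>

text \<open>Homotheties are written as matrices, so that classes of lattices are handled by matrix
  identities.\<close>

definition smat :: "'k \<Rightarrow> 'k^2^2" where "smat c = mk2 c 0 0 c"

lemma smat_mult_vec: "smat c *v x = c *s x"
  by (simp add: smat_def vec_eq_iff forall_2 matrix_vector_mult_def sum_2)

lemma smat_commute: "smat c ** M = M ** smat c"
  by (cases M rule: mat2_cases) (simp add: smat_def mult.commute)

lemma det_smat [simp]: "det (smat c) = c\<^sup>2"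
  by (simp add: smat_def power2_eq_square)

lemma smat_mult: "smat c ** smat d = smat (c * d)"
  by (simp add: smat_def)

lemma smat_1: "smat 1 = mat 1"
  by (simp add: smat_def mat_1_mk2)

lemma image_lat: "(\<lambda>x. A *v x) ` lat v g = lat v (A ** g)"
  unfolding lat_def by (auto simp: image_iff simp flip: matrix_vector_mul_assoc)

lemma vtx_smat: "vtx v g = {lat v (smat c ** g) | c. c \<noteq> 0}"
  unfolding vtx_def by (simp add: smat_mult_vec[symmetric] image_lat)

lemma bt_act_vtx: "bt_act A (vtx v g) = vtx v (A ** g)"
proof -
  have "(\<lambda>x. A *v x) ` lat v (smat c ** g) = lat v (smat c ** (A ** g))" for c
    by (simp add: image_lat) (metis matrix_mul_assoc smat_commute)
  then show ?thesis unfolding bt_act_def vtx_smat by (simp add: setcompr_eq_image image_image)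
qed

lemma lat_mult_subset:
  assumes "int2 U" shows "lat v (g ** U) \<subseteq> lat v g"
proof
  fix y assume "y \<in> lat v (g ** U)"
  then obtain x where x: "y = (g ** U) *v x" "\<forall>i. vge v (x$i) 0" by (auto simp: lat_def)
  have "\<forall>i. vge v ((U *v x)$i) 0"
    using x(2) assms by (auto simp: int2_def matrix_vector_mult_def sum_2 intro!: vge_add vge_mult0)
  then show "y \<in> lat v g" unfolding lat_def using x(1) by (auto simp flip: matrix_vector_mul_assoc)
qed

lemma lat_mult_unit:
  assumes "int2 U" "det U \<noteq> 0" "v (det U) = 0" shows "lat v (g ** U) = lat v g"
proof -
  obtain W where W: "int2 W" "U ** W = mat 1" using int2_inverse[OF assms] by metis
  have "lat v g = lat v (g ** U ** W)" using W by (metis matrix_mul_assoc matrix_mul_rid)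
  then show ?thesis using lat_mult_subset[OF assms(1), of g] lat_mult_subset[OF W(1), of "g ** U"] by blast
qed

lemma vtx_smat_mult: "c \<noteq> 0 \<Longrightarrow> vtx v (smat c ** g) = vtx v g"
proof -
  assume c: "c \<noteq> 0"
  have "{lat v (smat d ** (smat c ** g)) | d. d \<noteq> 0} = {lat v (smat d ** g) | d. d \<noteq> 0}"
  proof (intro Collect_cong iffI; clarify)
    fix d :: 'k assume "d \<noteq> 0"
    then show "\<exists>e. lat v (smat d ** (smat c ** g)) = lat v (smat e ** g) \<and> e \<noteq> 0"
      using c by (metis matrix_mul_assoc mult_eq_0_iff smat_mult)
  next
    fix d :: 'k assume "d \<noteq> 0"
    then have "smat d ** g = smat (d / c) ** (smat c ** g)" "d / c \<noteq> 0"
      using c by (simp_all add: matrix_mul_assoc smat_mult)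
    then show "\<exists>e. lat v (smat d ** g) = lat v (smat e ** (smat c ** g)) \<and> e \<noteq> 0" by metis
  qed
  then show ?thesis unfolding vtx_smat .
qed

lemma vtx_mult_unit:
  assumes "int2 U" "det U \<noteq> 0" "v (det U) = 0" shows "vtx v (g ** U) = vtx v g"
  unfolding vtx_smat using lat_mult_unit[OF assms] by (simp add: matrix_mul_assoc)

text \<open>The columns of \<open>h\<close> are the images of the unit vectors, so they lie in the
  lattice of \<open>g\<close>; their coordinates there are the columns of \<open>U\<close>.\<close>

lemma lat_subset_imp:
  assumes "lat v h \<subseteq> lat v g"
  obtains U where "int2 U" "h = g ** U"
proof -
  have col: "\<exists>x. (\<chi> i. h$i$j) = g *v x \<and> (\<forall>i. vge v (x$i) 0)" for j
  proof -
    have "h *v Finite_Cartesian_Product.axis j 1 \<in> lat v h"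
      unfolding lat_def by (auto simp: Finite_Cartesian_Product.axis_def)
    moreover have "h *v Finite_Cartesian_Product.axis j 1 = (\<chi> i. h$i$j)"
      by (simp add: vec_eq_iff matrix_vector_mult_def Finite_Cartesian_Product.axis_def if_distrib cong: if_cong)
    ultimately have "(\<chi> i. h$i$j) \<in> lat v g" using assms by auto
    then show ?thesis by (auto simp: lat_def)
  qed
  obtain x where x: "(\<chi> i. h$i$1) = g *v x" "\<forall>i. vge v (x$i) 0" using col by blast
  obtain y where y: "(\<chi> i. h$i$2) = g *v y" "\<forall>i. vge v (y$i) 0" using col by blast
  have "h = g ** mk2 (x$1) (y$1) (x$2) (y$2)"
    using x(1) y(1)
    by (simp add: mat2_eq_iff vec_eq_iff forall_2 matrix_vector_mult_def matrix_matrix_mult_def sum_2)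
  then show thesis using x(2) y(2) by (intro that[of "mk2 (x$1) (y$1) (x$2) (y$2)"]) simp_all
qed

text \<open>The two inclusions of lattices give integral \<open>U\<close> and \<open>W\<close> with
  det U det W = 1, so both determinants are units.\<close>

lemma vtx_eqD:
  assumes "det g \<noteq> 0" "det h \<noteq> 0" "vtx v g = vtx v h"
  obtains c U where "c \<noteq> 0" "int2 U" "det U \<noteq> 0" "v (det U) = 0" "h = smat c ** g ** U"
proof -
  have "lat v (smat 1 ** h) \<in> vtx v h" unfolding vtx_smat by force
  then have "lat v h \<in> vtx v g" using assms(3) by (simp add: smat_1)
  then obtain c where c: "c \<noteq> 0" "lat v h = lat v (smat c ** g)" by (auto simp: vtx_smat)
  obtain U where U: "int2 U" "h = smat c ** g ** U" using lat_subset_imp c(2) by (metis order_refl)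
  obtain W where W: "int2 W" "smat c ** g = h ** W" using lat_subset_imp c(2) by (metis order_refl)
  have "det (smat c ** g) = det (smat c ** g) * (det U * det W)"
    using U(2) W(2) by (metis det_mul mult.assoc)
  then have 1: "det U * det W = 1" using assms(1) c(1) by (simp add: det_mul)
  then have nz: "det U \<noteq> 0" "det W \<noteq> 0" by auto
  have "v (det U) + v (det W) = 0" using 1 nz v_mult by (metis v_one)
  moreover have "v (det U) \<ge> 0" "v (det W) \<ge> 0"
    using int2_det U(1) W(1) nz by (auto simp: vge_def)
  ultimately show thesis using that c U nz by auto
qed

text \<open>\<open>bt_dist\<close> evaluates its formula at bases picked by \<open>SOME\<close>. The
  value does not depend on them: GL_2(O) preserves both terms, and a homothety by e adds 2 v(e) to
  each.\<close>

lemma bt_dist_vtx: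
  assumes g: "det g \<noteq> 0" and M: "det M \<noteq> 0" and h: "h = g ** M"
  shows "bt_dist v (vtx v g) (vtx v h) = nat (v (det M) - 2 * mval M)"
proof -
  have h0: "det h \<noteq> 0" using g M h by (simp add: det_mul)
  define g0 where "g0 = (SOME x. det x \<noteq> 0 \<and> vtx v g = vtx v x)"
  define h0 where "h0 = (SOME x. det x \<noteq> 0 \<and> vtx v h = vtx v x)"
  have g0: "det g0 \<noteq> 0" "vtx v g = vtx v g0"
    unfolding g0_def by (rule someI2[of _ g]; use g in auto)+
  have h0': "det h0 \<noteq> 0" "vtx v h = vtx v h0"
    unfolding h0_def by (rule someI2[of _ h]; use h0 in auto)+
  obtain c U where U: "c \<noteq> 0" "int2 U" "det U \<noteq> 0" "v (det U) = 0" "g0 = smat c ** g ** U"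
    using vtx_eqD[OF g g0] by metis
  obtain d W where W: "d \<noteq> 0" "int2 W" "det W \<noteq> 0" "v (det W) = 0" "h0 = smat d ** h ** W"
    using vtx_eqD[OF h0 h0'] by metis
  obtain U' where U': "int2 U'" "U ** U' = mat 1" "det U' \<noteq> 0" "v (det U') = 0"
    using int2_inverse[OF U(2-4)] by metis
  define N where "N = U' ** M ** W"
  have "g0 ** (smat (d / c) ** N) = smat (d / c) ** g0 ** N"
    by (metis matrix_mul_assoc smat_commute)
  also have "smat (d / c) ** g0 = smat d ** g ** U"
    using U(1) by (simp add: U(5) matrix_mul_assoc smat_mult)
  also have "\<dots> ** N = h0"
    unfolding N_def W(5) h using U'(2) by (metis matrix_mul_assoc matrix_mul_rid)
  finally have "matrix_inv g0 ** h0 = smat (d / c) ** N"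
    using matrix_inv_mult(2)[OF g0(1)] by (metis matrix_mul_assoc matrix_mul_lid)
  moreover have "mval N = mval M" unfolding N_def by (intro mval_mult_unit M U' W)
  moreover have N0: "det N \<noteq> 0" "v (det N) = v (det M)"
    unfolding N_def using M U' W by (simp_all add: det_mul v_mult)
  moreover have "mval (smat e ** N) = v e + mval N" if e: "e \<noteq> 0" for e
  proof -
    have "det (smat e ** N) \<noteq> 0" using N0 e by (simp add: det_mul)
    then have nz: "N \<noteq> 0" "smat e ** N \<noteq> 0" using N0 by auto
    have "(\<forall>i j. vge v ((smat e ** N)$i$j) n) \<longleftrightarrow> (\<forall>i j. vge v (N$i$j) (n - v e))" for n
      by (cases N rule: mat2_cases) (simp add: smat_def forall_2 vge_mult_cancel[OF e])
    then have "n \<le> mval (smat e ** N) \<longleftrightarrow> n - v e \<le> mval N" for n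
      using vge_mval_iff[OF nz(1)] vge_mval_iff[OF nz(2)] by metis
    then have "n \<le> mval (smat e ** N) \<longleftrightarrow> n \<le> v e + mval N" for n by (simp add: algebra_simps)
    then show ?thesis by (metis order_antisym order_refl)
  qed
  moreover have "v (det (smat (d / c) ** N)) = 2 * v (d / c) + v (det N)"
    using U(1) W(1) N0 by (simp add: det_mul v_mult v_power)
  ultimately show ?thesis
    unfolding bt_dist_def mat_dist_mval g0_def[symmetric] h0_def[symmetric] using U(1) W(1) by simp
qed

lemma bt_verts_cases:
  assumes "X \<in> bt_verts v" obtains g where "det g \<noteq> 0" "X = vtx v g"
  using assms by (auto simp: bt_verts_def)

lemma vtx_in_verts [simp]: "det g \<noteq> 0 \<Longrightarrow> vtx v g \<in> bt_verts v"
  by (auto simp: bt_verts_def)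

lemma bt_dist_move:
  assumes "det g \<noteq> 0" "det M = 1" "A ** g = g ** M"
  shows "bt_dist v (vtx v g) (bt_act A (vtx v g)) = nat (- 2 * mval M)"
  using bt_dist_vtx[OF assms(1), of M] assms by (simp add: bt_act_vtx)

text \<open>Equal vertices give \<open>M = smat c ** U\<close> with \<open>U\<close> in GL_2(O);
  determinant 1 forces v(c) = 0, so fixing the class of a lattice means fixing the lattice.\<close>

lemma bt_act_fix_iff:
  assumes "det g \<noteq> 0" "det M = 1" "A ** g = g ** M"
  shows "bt_act A (vtx v g) = vtx v g \<longleftrightarrow> int2 M"
proof
  assume "int2 M"
  then show "bt_act A (vtx v g) = vtx v g"
    using assms by (simp add: bt_act_vtx vtx_mult_unit)
next
  assume "bt_act A (vtx v g) = vtx v g"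
  then have eq: "vtx v g = vtx v (g ** M)" using assms by (simp add: bt_act_vtx)
  obtain c U where U: "c \<noteq> 0" "int2 U" "det U \<noteq> 0" "v (det U) = 0" "g ** M = smat c ** g ** U"
    using vtx_eqD[OF assms(1) _ eq] assms by (auto simp: det_mul)
  have "M = smat c ** U"
    using U(5) by (metis matrix_left_cancel assms(1) matrix_mul_assoc smat_commute)
  moreover have "c\<^sup>2 * det U = 1" using assms(2) calculation by (simp add: det_mul)
  then have "2 * v c + v (det U) = 0" using v_mult[of "c\<^sup>2" "det U"] U by (simp add: v_power)
  then have "vge v c 0" using U by (simp add: vge_def)
  then have "int2 (smat c)" by (simp add: smat_def)
  ultimately show "int2 M" using int2_mult U(2) by simp
qed

end

section \<open>Translation lengths and fixed points\<close>

context dval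
begin

text \<open>The companion matrix is integral as soon as the trace is, so the lattice spanned by w
  and Aw is invariant for a cyclic vector w.\<close>

lemma integral_trace_imp_fix:
  assumes "det A = 1" "vge v (tr2 A) 0"
  obtains Q M where "det Q \<noteq> 0" "det M = 1" "A ** Q = Q ** M" "int2 M"
proof (cases "\<exists>x. A = mk2 x 0 0 x")
  case True
  then obtain x where A: "A = mk2 x 0 0 x" by blast
  then have "x = 1 \<or> x = -1" using SL2_scalar assms(1) by auto
  then have "int2 A" using A by auto
  then show ?thesis using that[of "mat 1" A] assms by simp
next
  case False
  then obtain Q where "det Q \<noteq> 0" "A ** Q = Q ** mk2 0 (-1) 1 (tr2 A)"
    using companion_frame[OF assms(1)] by metis
  then show ?thesis using that[of Q "mk2 0 (-1) 1 (tr2 A)"] assms(2) by simp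
qed

lemma elliptic_imp_integral_trace:
  assumes "det A = 1" "elliptic v A"
  shows "vge v (tr2 A) 0"
proof -
  obtain g where g: "det g \<noteq> 0" "bt_act A (vtx v g) = vtx v g"
    using assms(2) by (auto simp: elliptic_def fix_set_def bt_verts_def)
  obtain M where M: "A ** g = g ** M" "det M = 1" using frame_exists[OF g(1)] assms(1) by metis
  have "int2 M" using bt_act_fix_iff g M by blast
  then show ?thesis
    using tr2_frame[OF g(1) M(1)] by (auto simp: tr2_def int2_def intro: vge_add)
qed

lemma trans_len_integral:
  assumes "det A = 1" "vge v (tr2 A) 0"
  shows "trans_len v A = 0"
proof -
  obtain Q M where Q: "det Q \<noteq> 0" "det M = 1" "A ** Q = Q ** M" "int2 M"
    using integral_trace_imp_fix[OF assms] by metis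
  have "M \<noteq> 0" using Q(2) by auto
  then have "mval M \<ge> 0" using Q(4) by (simp add: vge_mval_iff int2_def)
  then have "bt_dist v (vtx v Q) (bt_act A (vtx v Q)) = 0" using bt_dist_move[OF Q(1-3)] by simp
  then show ?thesis unfolding trans_len_def using Q(1)
    by (intro Least_eq_0) (auto intro!: bexI[of _ "vtx v Q"])
qed

lemma mval_le_tr:
  assumes "tr2 M \<noteq> 0"
  shows "mval M \<le> v (tr2 M)"
proof -
  have "vge v (tr2 M) (mval M)" unfolding tr2_def by (intro vge_add vge_mval)
  then show ?thesis using assms by (simp add: vge_def)
qed

text \<open>In any basis the trace is a sum of two entries, so the least entry valuation is at most
  v(tr A); this bounds every displacement from below. The companion matrix attains the
  bound.\<close>

lemma trans_len_hyperbolic: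
  assumes A: "det A = 1" and t: "tr2 A \<noteq> 0" "v (tr2 A) < 0"
  shows "trans_len v A = nat (- 2 * v (tr2 A))"
proof -
  have "A \<noteq> mk2 x 0 0 x" for x
  proof
    assume *: "A = mk2 x 0 0 x"
    then have "x = 1 \<or> x = -1" using SL2_scalar A by auto
    then have "vge v (tr2 A) 0" using * vge_numeral[of "num.Bit0 num.One"]
      vge_uminus[of 2 0] by auto
    then show False using t by (simp add: vge_def)
  qed
  then obtain Q where Q: "det Q \<noteq> 0" "A ** Q = Q ** mk2 0 (-1) 1 (tr2 A)"
    using companion_frame[OF A] by metis
  let ?M = "mk2 0 (-1) 1 (tr2 A)"
  have M0: "?M \<noteq> 0" by (metis mk2_nth(3) zero_index zero_neq_one)
  have "v (tr2 A) \<le> mval ?M"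
    unfolding vge_mval_iff[OF M0] using t by (auto simp: forall_2 vge_def)
  then have mv: "mval ?M = v (tr2 A)" using mval_le_tr[of ?M] t by simp
  have "bt_dist v (vtx v Q) (bt_act A (vtx v Q)) = nat (- 2 * v (tr2 A))"
    using bt_dist_move[OF Q(1) _ Q(2)] mv by simp
  moreover have "nat (- 2 * v (tr2 A)) \<le> bt_dist v X (bt_act A X)" if X: "X \<in> bt_verts v" for X
  proof -
    obtain g where g: "det g \<noteq> 0" "X = vtx v g" using bt_verts_cases[OF X] by metis
    obtain M where M: "A ** g = g ** M" "det M = 1" using frame_exists[OF g(1)] A by metis
    have "mval M \<le> v (tr2 A)" using mval_le_tr[of M] tr2_frame[OF g(1) M(1)] t by simp
    then show ?thesis using bt_dist_move[OF g(1) M(2,1)] g(2) by simp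
  qed
  ultimately show ?thesis unfolding trans_len_def
    by (intro Least_equality) (use Q(1) in \<open>auto intro!: bexI[of _ "vtx v Q"]\<close>)
qed

lemma hyperbolic_iff:
  assumes "det A = 1"
  shows "hyperbolic v A \<longleftrightarrow> tr2 A \<noteq> 0 \<and> v (tr2 A) < 0"
  using trans_len_integral[OF assms] trans_len_hyperbolic[OF assms] not_vge
  unfolding hyperbolic_def by (metis neq0_conv zero_less_nat_eq neg_0_less_iff_less mult_minus_left
      mult_pos_neg zero_less_numeral)

text \<open>If \<open>M\<close> is the matrix passing from one fixed lattice to the other, a column of \<open>M\<close> of minimal
  valuation is an eigenvector modulo \<open>\<pi>\<^sup>m\<close>, where \<open>m\<close> is the distance; \<open>\<lambda>\<close> is its eigenvalue.\<close>

lemma fix_dist_imp_approx_root: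
  assumes A: "det A = 1" and X: "X \<in> fix_set v A" and Y: "Y \<in> fix_set v A"
  obtains l where "vge v l 0" "vge v (l\<^sup>2 - tr2 A * l + 1) (int (bt_dist v X Y))"
proof -
  obtain g where g: "det g \<noteq> 0" "X = vtx v g" using X bt_verts_cases by (auto simp: fix_set_def)
  obtain h where h: "det h \<noteq> 0" "Y = vtx v h" using Y bt_verts_cases by (auto simp: fix_set_def)
  obtain G where G: "A ** g = g ** G" "det G = 1" using frame_exists[OF g(1)] A by metis
  obtain H where H: "A ** h = h ** H" "det H = 1" using frame_exists[OF h(1)] A by metis
  have iG: "int2 G" using X g bt_act_fix_iff[OF g(1) G(2,1)] by (simp add: fix_set_def)
  have iH: "int2 H" using Y h bt_act_fix_iff[OF h(1) H(2,1)] by (simp add: fix_set_def)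
  define M where "M = matrix_inv g ** h"
  have hM: "h = g ** M" unfolding M_def
    using matrix_inv_mult(1)[OF g(1)] by (metis matrix_mul_assoc matrix_mul_lid)
  have dM: "det M \<noteq> 0" using h(1) hM by (auto simp: det_mul)
  have GM: "G ** M = M ** H"
    using matrix_left_cancel[OF g(1), of "G ** M" "M ** H"] G(1) H(1) hM
    by (metis matrix_mul_assoc)
  have dist: "bt_dist v X Y = nat (v (det M) - 2 * mval M)"
    using bt_dist_vtx[OF g(1) dM hM] g h by simp
  obtain a b c d where Ge: "G = mk2 a b c d" by (rule mat2_cases)
  obtain e f k l where He: "H = mk2 e f k l" by (rule mat2_cases)
  obtain p q r w where Me: "M = mk2 p q r w" by (rule mat2_cases)
  have t: "tr2 A = a + d" using tr2_frame[OF g(1) G(1)] Ge by simp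
  have det1: "a * d - b * c = 1" using G(2) Ge by simp
  have int: "vge v a 0" "vge v b 0" "vge v c 0" "vge v d 0"
    "vge v e 0" "vge v f 0" "vge v k 0" "vge v l 0"
    using iG iH Ge He by auto
  have com: "a*p + b*r = p*e + q*k" "a*q + b*w = p*f + q*l"
            "c*p + d*r = r*e + w*k" "c*q + d*w = r*f + w*l"
    using GM unfolding Ge He Me by auto
  have entries: "vge v p (mval M)" "vge v q (mval M)" "vge v r (mval M)" "vge v w (mval M)"
    using vge_mval[of M] unfolding Me by (metis mk2_nth)+
  \<comment> \<open>\<open>Q\<close> is the determinant with columns w = (x, y) and Gw, so it
    vanishes on eigenvectors. On the columns of \<open>M\<close> it is a multiple of det M by an
    integer of the field, since GM = MH with \<open>H\<close> integral.\<close>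
  define Q where "Q x y = c * x\<^sup>2 + (d - a) * x * y - b * y\<^sup>2" for x y
  have Q1: "Q p r = k * (p * w - q * r)"
  proof -
    have "Q p r = p * (c*p + d*r) - r * (a*p + b*r)" by (simp add: Q_def power2_eq_square algebra_simps)
    then show ?thesis unfolding com by (simp add: algebra_simps)
  qed
  have Q2: "Q q w = (- f) * (p * w - q * r)"
  proof -
    have "Q q w = q * (c*q + d*w) - w * (a*q + b*w)" by (simp add: Q_def power2_eq_square algebra_simps)
    then show ?thesis unfolding com by (simp add: algebra_simps)
  qed
  have vdet: "vge v (p * w - q * r) (v (det M))" using vge_v[of "det M"] by (simp add: Me)
  note root_found = that
  have main: thesis if xy: "vge v x (mval M)" "vge v y (mval M)" "vge v (Q x y) (v (det M))"
    and u: "x \<noteq> 0 \<and> v x = mval M \<or> y \<noteq> 0 \<and> v y = mval M" for x y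
    using u
  proof
    assume x: "x \<noteq> 0 \<and> v x = mval M"
    \<comment> \<open>The approximate eigenvalue: the first coordinate of \<open>G\<close> applied
      to (1, y / x). Minimality of v x keeps y / x integral.\<close>
    let ?l = "a + b * (y / x)"
    have "vge v (y / x) 0" using vge_divide[OF xy(2), of x] x by simp
    then have "vge v ?l 0" using int by (intro vge_intros)
    moreover have "?l\<^sup>2 - tr2 A * ?l + 1 = (- b) * (Q x y / x\<^sup>2)"
    proof -
      have "?l\<^sup>2 - tr2 A * ?l + (a * d - b * c) = (- b) * (Q x y / x\<^sup>2)"
        unfolding t Q_def using x by (simp add: field_simps power2_eq_square)
      then show ?thesis using det1 by simp
    qed
    moreover have "vge v ((- b) * (Q x y / x\<^sup>2)) (v (det M) - 2 * mval M)"
      using vge_divide[OF xy(3), of "x\<^sup>2"] x int by (intro vge_mult_left) (auto simp: v_power)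
    \<comment> \<open>\<open>nat\<close> truncates the distance at 0; integrality settles the case
      of a negative exponent.\<close>
    moreover have "vge v (?l\<^sup>2 - tr2 A * ?l + 1) 0"
      using calculation(1) int t by (auto intro!: vge_intros)
    ultimately show thesis using root_found[of ?l] dist by (cases "v (det M) - 2 * mval M \<ge> 0") auto
  next
    assume y: "y \<noteq> 0 \<and> v y = mval M"
    let ?l = "d + c * (x / y)"
    have "vge v (x / y) 0" using vge_divide[OF xy(1), of y] y by simp
    then have "vge v ?l 0" using int by (intro vge_intros)
    moreover have "?l\<^sup>2 - tr2 A * ?l + 1 = c * (Q x y / y\<^sup>2)"
    proof -
      have "?l\<^sup>2 - tr2 A * ?l + (a * d - b * c) = c * (Q x y / y\<^sup>2)"
        unfolding t Q_def using y by (simp add: field_simps power2_eq_square)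
      then show ?thesis using det1 by simp
    qed
    moreover have "vge v (c * (Q x y / y\<^sup>2)) (v (det M) - 2 * mval M)"
      using vge_divide[OF xy(3), of "y\<^sup>2"] y int by (intro vge_mult_left) (auto simp: v_power)
    moreover have "vge v (?l\<^sup>2 - tr2 A * ?l + 1) 0"
      using calculation(1) int t by (auto intro!: vge_intros)
    ultimately show thesis using root_found[of ?l] dist by (cases "v (det M) - 2 * mval M \<ge> 0") auto
  qed
  have "M \<noteq> 0" using dM by auto
  then obtain i j where ij: "M$i$j \<noteq> 0" "v (M$i$j) = mval M" using mval_attained by metis
  have "(j = 1 \<and> (p \<noteq> 0 \<and> v p = mval M \<or> r \<noteq> 0 \<and> v r = mval M)) \<or>
        (j = 2 \<and> (q \<noteq> 0 \<and> v q = mval M \<or> w \<noteq> 0 \<and> v w = mval M))"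
    using ij exhaust_2[of i] exhaust_2[of j] unfolding Me by auto
  then show thesis
    using main[of p r] main[of q w] Q1 Q2 entries vdet vge_mult_left[OF int(7) vdet]
      vge_mult_left[of "- f", OF _ vdet] int(6) by auto
qed

section \<open>Elementary groups\<close>

lemma elementary_vertex:
  assumes "det A = 1" "det B = 1" "det P \<noteq> 0"
    "A ** P = P ** A'" "int2 A'" "B ** P = P ** B'" "int2 B'"
  shows "elementary v (gen2 A B)"
proof -
  have "det A' = 1" "det B' = 1"
    using assms det_frame by metis+
  then have AB: "bt_act A (vtx v P) = vtx v P" "bt_act B (vtx v P) = vtx v P"
    using bt_act_fix_iff assms by blast+
  have "bt_act g (vtx v P) = vtx v P" if "g \<in> gen2 A B" for g
    using that
  proof induction
    case (gen_mult g h)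
    then show ?case by (metis bt_act_vtx matrix_mul_assoc)
  next
    case (gen_inv g)
    have "matrix_inv g ** g = mat 1"
      using det_gen2[OF assms(1,2) gen_inv(1)] by (simp add: matrix_inv_mult)
    then show ?case using gen_inv.IH by (metis bt_act_vtx matrix_mul_assoc matrix_mul_lid)
  qed (use AB in \<open>auto simp: bt_act_vtx\<close>)
  then show ?thesis unfolding elementary_def using assms(3) vtx_in_verts by blast
qed

text \<open>The vertices \<open>vtx v (P ** dg \<pi> n)\<close> run along the apartment of the basis
  \<open>P\<close>, one edge for each n.\<close>

definition dg :: "'k \<Rightarrow> int \<Rightarrow> 'k^2^2" where "dg \<pi> n = mk2 1 0 0 (\<pi> powi n)"

lemma dg_mult: "\<pi> \<noteq> 0 \<Longrightarrow> dg \<pi> m ** dg \<pi> n = dg \<pi> (m + n)"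
  by (simp add: dg_def power_int_add)

lemma det_dg: "\<pi> \<noteq> 0 \<Longrightarrow> det (dg \<pi> n) \<noteq> 0"
  by (simp add: dg_def)

lemma mval_mk2:
  assumes "mk2 a b c d \<noteq> 0"
  shows "n \<le> mval (mk2 a b c d) \<longleftrightarrow> vge v a n \<and> vge v b n \<and> vge v c n \<and> vge v d n"
  using vge_mval_iff[OF assms] by (auto simp: forall_2)

lemma bt_dist_dg:
  assumes "\<pi> \<noteq> 0" "v \<pi> = 1" "det P \<noteq> 0"
  shows "bt_dist v (vtx v (P ** dg \<pi> m)) (vtx v (P ** dg \<pi> n)) = nat \<bar>m - n\<bar>"
proof -
  have nz: "dg \<pi> (n - m) \<noteq> 0" using det_dg[OF assms(1)] by (metis det2_0)
  have "x \<le> mval (dg \<pi> (n - m)) \<longleftrightarrow> x \<le> min 0 (n - m)" for x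
    using mval_mk2[of 1 0 0 "\<pi> powi (n - m)" x] nz assms
    unfolding dg_def by (auto simp: vge_def v_power_int)
  then have "mval (dg \<pi> (n - m)) = min 0 (n - m)" by (metis order_antisym order_refl)
  moreover have "det (P ** dg \<pi> m) \<noteq> 0" using assms by (simp add: det_mul det_dg)
  moreover have "P ** dg \<pi> n = P ** dg \<pi> m ** dg \<pi> (n - m)"
    using assms(1) by (simp add: dg_mult flip: matrix_mul_assoc)
  moreover have "v (det (dg \<pi> (n - m))) = n - m" using assms by (simp add: dg_def v_power_int)
  ultimately show ?thesis
    using bt_dist_vtx[OF _ det_dg[OF assms(1)], of "P ** dg \<pi> m" _ "n - m"] by (auto simp: min_def)
qed

text \<open>The first column of \<open>P\<close> is a common eigenvector, and its line is an end of
  the tree, reached by the lattices spanned by that column and \<pi>^n times the second one. Upper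
  triangular matrices shift this ray far out.\<close>

lemma elementary_eigenvector:
  assumes AB: "det A = 1" "det B = 1" and P: "det P \<noteq> 0"
    and A: "A ** P = P ** mk2 a1 a2 0 a3" and B: "B ** P = P ** mk2 b1 b2 0 b3"
  shows "elementary v (gen2 A B)"
proof -
  have upper: "\<exists>a b d. g ** P = P ** mk2 a b 0 d \<and> a * d = 1" if "g \<in> gen2 A B" for g
    using that
  proof induction
    case gen_one
    show ?case by (rule exI[of _ 1], rule exI[of _ 0], rule exI[of _ 1]) (simp add: mat_1_mk2[symmetric])
  next
    case gen_A
    show ?case using A det_frame[OF P A] AB by auto
  next
    case gen_B
    show ?case using B det_frame[OF P B] AB by auto
  next
    case (gen_mult g h)
    then obtain a b d a' b' d' where
      gh: "g ** P = P ** mk2 a b 0 d" "h ** P = P ** mk2 a' b' 0 d'" "a * d = 1" "a' * d' = 1"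
      by auto
    have "g ** h ** P = P ** (mk2 a b 0 d ** mk2 a' b' 0 d')"
      using gh(1,2) by (metis matrix_mul_assoc)
    moreover have "(a * a') * (d * d') = 1" using gh(3,4) by (metis mult.commute mult.left_commute mult.right_neutral)
    ultimately show ?case by auto
  next
    case (gen_inv g)
    then obtain a b d where g: "g ** P = P ** mk2 a b 0 d" "a * d = 1" by auto
    have i: "mk2 a b 0 d ** mk2 d (-b) 0 a = mat 1" using g(2) by (simp add: mat_1_mk2 mult.commute)
    have "matrix_inv g ** g = mat 1"
      using det_gen2[OF AB gen_inv(1)] by (simp add: matrix_inv_mult)
    then have "matrix_inv g ** P = P ** mk2 d (-b) 0 a"
      using g(1) i by (metis matrix_mul_assoc matrix_mul_lid matrix_mul_rid)
    then show ?case using g(2) by (metis mult.commute)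
  qed
  obtain \<pi> where \<pi>: "\<pi> \<noteq> 0" "v \<pi> = 1" by (rule uniformizer)
  define r where "r n = vtx v (P ** dg \<pi> (int n))" for n
  have "ray v r"
    unfolding ray_def r_def using P \<pi> by (simp add: bt_dist_dg det_mul det_dg)
  moreover have "same_end (bt_act g \<circ> r) r" if gG: "g \<in> gen2 A B" for g
  proof -
    obtain a b d where g: "g ** P = P ** mk2 a b 0 d" "a * d = 1" using upper[OF gG] by auto
    have nz: "a \<noteq> 0" "d \<noteq> 0" using g(2) by auto
    have vd: "v d = - v a" using v_mult[OF nz] g(2) by simp
    \<comment> \<open>Beyond \<open>i\<close> the entry b \<pi>^m / a is integral and is absorbed in
      \<open>U\<close>. Since v(d / a) = - 2 v(a), the shift is by 2 v(a); the second summand keeps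
      \<open>j\<close> from being truncated.\<close>
    define i where "i = nat \<bar>v a - v b\<bar> + nat \<bar>2 * v a\<bar>"
    define j where "j = nat (int i - 2 * v a)"
    have j: "int j = int i - 2 * v a" unfolding i_def j_def by arith
    have "bt_act g (r (i + n)) = r (j + n)" for n
    proof -
      let ?m = "int (i + n)"
      define U where "U = mk2 1 (b * \<pi> powi ?m / a) 0 (d / a * \<pi> powi (2 * v a))"
      have m: "?m = int (j + n) + 2 * v a" using j by simp
      have "vge v (b * \<pi> powi ?m / a) 0"
        using nz \<pi> unfolding i_def by (cases "b = 0") (auto simp: vge_def v_divide v_mult v_power_int)
      moreover have u: "d / a * \<pi> powi (2 * v a) \<noteq> 0" "v (d / a * \<pi> powi (2 * v a)) = 0"
        using nz \<pi> vd by (simp_all add: v_mult v_divide v_power_int)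
      ultimately have U: "int2 U" "det U \<noteq> 0" "v (det U) = 0"
        unfolding U_def by (auto simp: vge_def)
      have "smat a ** dg \<pi> (int (j + n)) ** U = mk2 a b 0 d ** dg \<pi> ?m"
        unfolding m unfolding U_def smat_def dg_def m[symmetric]
        using nz \<pi> by (simp add: m power_int_add del: of_nat_add)
      moreover have "smat a ** (P ** X) ** U = P ** (smat a ** X ** U)" for X
        by (simp add: matrix_mul_assoc smat_commute[of a P])
      moreover have "g ** (P ** X) = P ** (mk2 a b 0 d ** X)" for X
        by (simp add: matrix_mul_assoc g(1) del: mk2_mult)
      ultimately have "g ** (P ** dg \<pi> ?m) = smat a ** (P ** dg \<pi> (int (j + n))) ** U"
        by (simp only:)
      then show ?thesis
        unfolding r_def bt_act_vtx using vtx_mult_unit[OF U] vtx_smat_mult[OF nz(1)] by simp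
    qed
    then show ?thesis unfolding same_end_def by (auto simp: comp_def)
  qed
  ultimately show ?thesis unfolding elementary_def by blast
qed

end

section \<open>Powers of matrices of determinant one\<close>

text \<open>By Cayley--Hamilton, \<open>g\<^sup>n = U\<^sub>n g - U\<^sub>n\<^sub>-\<^sub>1\<close> with the Chebyshev-type recursion below.\<close>

fun cheb :: "'a::comm_ring_1 \<Rightarrow> nat \<Rightarrow> 'a" where
  "cheb t 0 = 0"
| "cheb t (Suc 0) = 1"
| "cheb t (Suc (Suc n)) = t * cheb t (Suc n) - cheb t n"

lemma mpow_cheb:
  fixes a b c d :: "'a::field"
  assumes "a * d - b * c = 1"
  shows "mpow (mk2 a b c d) (Suc n) =
    mk2 (cheb (a+d) (Suc n) * a - cheb (a+d) n) (cheb (a+d) (Suc n) * b)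
        (cheb (a+d) (Suc n) * c) (cheb (a+d) (Suc n) * d - cheb (a+d) n)"
proof (induction n)
  case (Suc n)
  let ?U = "cheb (a+d)"
  have "a * (?U (Suc n) * a - ?U n) + b * (?U (Suc n) * c)
      = ((a+d) * ?U (Suc n) - ?U n) * a - (a*d-b*c) * ?U (Suc n)"
    "c * (?U (Suc n) * b) + d * (?U (Suc n) * d - ?U n)
      = ((a+d) * ?U (Suc n) - ?U n) * d - (a*d-b*c) * ?U (Suc n)"
    by algebra+
  then show ?case
    unfolding mpow_Suc[of _ "Suc n"] Suc.IH using assms by (simp add: algebra_simps)
qed (simp add: mat_1_mk2)

lemma mpow_2_mk2:
  assumes "a * d - b * c = (1::'a::field)"
  shows "mpow (mk2 a b c d) 2 = mk2 ((a+d)*a-1) ((a+d)*b) ((a+d)*c) ((a+d)*d-1)"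
  using mpow_cheb[OF assms, of 1] by (simp add: numeral_2_eq_2)

lemma tr2_mpow_2:
  assumes "det g = (1::'a::field)"
  shows "tr2 (mpow g 2) = (tr2 g)\<^sup>2 - 2"
proof (cases g rule: mat2_cases)
  case (1 a b c d)
  then show ?thesis using mpow_2_mk2[of a d b c] assms by (simp add: power2_eq_square algebra_simps)
qed

lemma mpow_3_mk2:
  assumes "a * d - b * c = (1::'a::field)"
  shows "mpow (mk2 a b c d) 3 = mk2 (((a+d)\<^sup>2-1)*a-(a+d)) (((a+d)\<^sup>2-1)*b) (((a+d)\<^sup>2-1)*c) (((a+d)\<^sup>2-1)*d-(a+d))"
  using mpow_cheb[OF assms, of 2] by (simp add: numeral_3_eq_3 numeral_2_eq_2)

text \<open>Cayley-Hamilton turns g^2 = 1 into (tr g) g = 2, so g is scalar.\<close>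

lemma mpow_2_eq_1:
  fixes g :: "'a::field^2^2"
  assumes "det g = 1" "mpow g 2 = mat 1" "(2::'a) \<noteq> 0"
  shows "g = mat 1 \<or> g = mk2 (-1) 0 0 (-1)"
proof -
  obtain a b c d where g: "g = mk2 a b c d" by (rule mat2_cases)
  have 1: "a * d - b * c = 1" using assms g by simp
  have "mpow g 2 = mk2 ((a+d)*a-1) ((a+d)*b) ((a+d)*c) ((a+d)*d-1)"
    using mpow_2_mk2[OF 1] g by simp
  then have e: "(a+d)*a = 2" "(a+d)*b = 0" "(a+d)*c = 0" "(a+d)*d = 2"
    using assms(2) by (auto simp: mat_1_mk2 algebra_simps)
  then have "a + d \<noteq> 0" using assms(3) by auto
  then have "b = 0" "c = 0" "a = d" using e by auto (metis mult_left_cancel)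
  then show ?thesis using 1 g by (auto simp: mat_1_mk2 square_eq_1_iff)
qed

section \<open>Congruence levels and elements of p-power order\<close>

context dval
begin

text \<open>At trace 2 the recursion has the solution U_n = n. Two consecutive values are carried
  along because the recursion has order two.\<close>

lemma cheb_approx:
  assumes "vge v (t - 2) k" "0 \<le> k"
  shows "vge v (cheb t n - of_nat n) k \<and> vge v (cheb t (Suc n) - of_nat (Suc n)) k"
proof (induction n)
  case (Suc n)
  have "vge v (t - 2 + 2) 0"
    by (intro vge_add vge_mono[OF assms] vge_numeral)
  then have i: "vge v t 0" by simp
  have "cheb t (Suc (Suc n)) - of_nat (Suc (Suc n)) =
     t * (cheb t (Suc n) - of_nat (Suc n)) - (cheb t n - of_nat n) + of_nat (Suc n) * (t - 2)"
    by (simp add: algebra_simps)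
  moreover have "vge v \<dots> k"
    using Suc assms(1) by (intro vge_add[OF vge_diff[OF vge_mult_left[OF i]] vge_mult_left[OF vge_of_nat]]) auto
  ultimately show ?case using Suc by (simp only:)
qed simp

text \<open>The first-order expansion U_n = n + (t - 2)(n^3 - n)/6 at trace 2, multiplied by 6 to
  avoid the division.\<close>

lemma cheb_approx2:
  assumes "vge v (t - 2) 1"
  shows "vge v (6 * cheb t n - 6 * of_nat n - (t - 2) * (of_nat n ^ 3 - of_nat n)) 2 \<and>
    vge v (6 * cheb t (Suc n) - 6 * of_nat (Suc n) - (t - 2) * (of_nat (Suc n) ^ 3 - of_nat (Suc n))) 2"
proof (induction n)
  case (Suc n)
  let ?e = "\<lambda>n. 6 * cheb t n - 6 * of_nat n - (t - 2) * (of_nat n ^ 3 - of_nat n)"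
  have "vge v (t - 2 + 2) 0"
    by (intro vge_add vge_mono[OF assms] vge_numeral) auto
  then have i: "vge v t 0" by simp
  have "vge v ((t-2) * (t - 2)) (1 + 1)" by (intro vge_mult assms)
  then have sq: "vge v ((t-2) * (t - 2)) 2" by simp
  have "?e (Suc (Suc n)) = t * ?e (Suc n) - ?e n + (of_nat (Suc n) ^ 3 - of_nat (Suc n)) * ((t - 2) * (t - 2))"
    by simp algebra
  moreover have "vge v \<dots> 2"
    using Suc sq
    by (intro vge_add[OF vge_diff[OF vge_mult_left[OF i]] vge_mult_left])
      (auto intro!: vge_diff vge_power0 simp del: of_nat_Suc)
  ultimately show ?case using Suc by (simp only:)
qed simp

definition one_mod :: "int \<Rightarrow> 'k^2^2 \<Rightarrow> bool" where
  "one_mod k M \<longleftrightarrow> (\<forall>i j. vge v ((M - mat 1)$i$j) k)"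

lemma one_mod_mk2: "one_mod k (mk2 a b c d) \<longleftrightarrow> vge v (a - 1) k \<and> vge v b k \<and> vge v c k \<and> vge v (d - 1) k"
  by (auto simp: one_mod_def mat_1_mk2 forall_2)

text \<open>In g^p = U_p g - U_(p-1) the trace condition gives U_p = p and U_(p-1) = p - 1 modulo
  \<pi>^(k+1). So U_p is divisible by \<pi>, and g^p is congruent to 1 one level deeper.\<close>

lemma one_mod_pow_p:
  assumes p: "vge v (of_nat p) 1" "p > 0" and g: "det g = 1" "int2 g" and t: "vge v (tr2 g - 2) m"
    and k: "one_mod k g" "0 \<le> k" "k + 1 \<le> m"
  shows "one_mod (k + 1) (mpow g p)"
proof -
  obtain a b c d where ge: "g = mk2 a b c d" by (rule mat2_cases)
  obtain n where n: "p = Suc n" using p(2) by (cases p) auto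
  have 1: "a * d - b * c = 1" using ge g by simp
  let ?U = "cheb (a+d)"
  have U: "vge v (?U n - of_nat n) (k + 1)" "vge v (?U p - of_nat p) (k + 1)"
    using cheb_approx[of "a+d" m n] t ge k n by (auto intro: vge_mono)
  have Up: "vge v (?U p) 1"
  proof -
    have "vge v (?U p - of_nat p + of_nat p) 1"
      using U(2) k(2) p(1) by (intro vge_add) (auto elim: vge_mono)
    then show ?thesis by simp
  qed
  have x: "vge v (?U p * x) (k + 1)" if "vge v x k" for x
    using vge_mult[OF Up that] by (simp add: add.commute)
  have "vge v (?U p * x - ?U n - 1) (k + 1)" if "vge v (x - 1) k" for x
  proof -
    have "?U p * x - ?U n - 1 = ?U p * (x - 1) + (?U p - of_nat p) - (?U n - of_nat n)"
      by (simp add: n algebra_simps)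
    moreover have "vge v \<dots> (k + 1)" by (intro vge_diff[OF vge_add] U x that)
    ultimately show ?thesis by (simp only:)
  qed
  then show ?thesis
    using k(1) x unfolding ge n mpow_cheb[OF 1] one_mod_mk2 by (simp add: n)
qed

text \<open>Determinant 1 cancels the linear terms in tr g - 2.\<close>

lemma one_mod_trace:
  assumes "one_mod k g" "det g = 1"
  shows "vge v (tr2 g - 2) (2 * k)"
proof -
  obtain a b c d where ge: "g = mk2 a b c d" by (rule mat2_cases)
  have 1: "a * d - b * c = 1" using ge assms by simp
  have o: "vge v (a - 1) k" "vge v b k" "vge v c k" "vge v (d - 1) k"
    using assms(1) ge one_mod_mk2 by auto
  have "tr2 g - 2 = b * c - (a - 1) * (d - 1)" using 1 ge by (simp add: algebra_simps)
  moreover have "vge v \<dots> (k + k)" using o by (intro vge_diff[OF vge_mult vge_mult])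
  ultimately show ?thesis by (simp only: mult_2)
qed

lemma one_mod_int2: "one_mod k g \<Longrightarrow> 0 \<le> k \<Longrightarrow> int2 g"
proof (cases g rule: mat2_cases)
  case (1 a b c d)
  assume a: "one_mod k g" "0 \<le> k"
  have "vge v (a - 1) 0" "vge v (d - 1) 0" "vge v b 0" "vge v c 0"
    using a unfolding 1 one_mod_mk2 by (auto intro: vge_mono)
  then have "vge v (a - 1 + 1) 0" "vge v (d - 1 + 1) 0" "vge v b 0" "vge v c 0"
    using vge_add[OF _ vge_1] by blast+
  then show ?thesis by (simp add: 1)
qed

text \<open>Level 0 is integrality. The step to level 1 uses the hypothesis on the trace; from level
  k \<ge> 1 on, \<open>one_mod_trace\<close> supplies depth 2k \<ge> k + 1.\<close>

lemma one_mod_pow_pk: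
  assumes p: "vge v (of_nat p) 1" "p > 0" and g: "det g = 1" "int2 g" and t: "vge v (tr2 g - 2) 1"
  shows "one_mod (int k) (mpow g (p ^ k))"
proof (induction k)
  case 0
  have "int2 (g - mat 1)"
    using g(2) by (cases g rule: mat2_cases) (auto simp: mat_1_mk2 intro: vge_diff)
  then show ?case by (simp add: one_mod_def int2_def)
next
  case (Suc k)
  have "one_mod (int k + 1) (mpow (mpow g (p ^ k)) p)"
  proof (cases "k = 0")
    case True
    then show ?thesis using one_mod_pow_p[OF p g t, of 0] Suc by simp
  next
    case False
    have d: "det (mpow g (p ^ k)) = 1" using g by (simp add: det_mpow)
    show ?thesis
      by (rule one_mod_pow_p[OF p d one_mod_int2[OF Suc] one_mod_trace[OF Suc d] Suc]) (use False in auto)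
  qed
  then show ?case by (simp add: mpow_mult[symmetric] mult.commute add.commute)
qed

lemma matrix_bounded_below: "\<exists>n. \<forall>i j. vge v ((M::'k^2^2)$i$j) n"
proof (cases "M = 0")
  case False
  then show ?thesis using vge_mval by blast
qed simp

text \<open>After conjugation into SL_2(O) the powers g^(p^k) converge to 1, so in a discrete group
  one of them equals 1.\<close>

lemma unipotent_finite_order:
  assumes p: "vge v (of_nat p) 1" "p > 0"
    and AB: "det A = 1" "det B = 1" and disc: "discrete_subgroup v (gen2 A B)"
    and g: "g \<in> gen2 A B" "vge v (tr2 g - 2) 1"
  obtains k where "mpow g (p ^ k) = mat 1"
proof -
  have dg: "det g = 1" using det_gen2 AB g by blast
  have "vge v (tr2 g - 2 + 2) 0"
    by (intro vge_add vge_mono[OF g(2)]) auto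
  then obtain Q M where Q: "det Q \<noteq> 0" "det M = 1" "g ** Q = Q ** M" "int2 M"
    using integral_trace_imp_fix[OF dg] by (metis diff_add_cancel)
  have tM: "vge v (tr2 M - 2) 1" using tr2_frame[OF Q(1,3)] g(2) by simp
  obtain N where N: "\<And>h. h \<in> gen2 A B \<Longrightarrow> (\<forall>i j. vge v (h$i$j - mat 1$i$j) N) \<Longrightarrow> h = mat 1"
    using disc gen_one unfolding discrete_subgroup_def by metis
  obtain e where e: "\<forall>i j. vge v (Q$i$j) e" using matrix_bounded_below by blast
  obtain f where f: "\<forall>i j. vge v (matrix_inv Q$i$j) f" using matrix_bounded_below by blast
  \<comment> \<open>\<open>e\<close> and \<open>f\<close> measure the loss of depth when conjugating
    back by \<open>Q\<close>; \<open>k\<close> makes up for it.\<close>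
  define k where "k = nat (N - e - f)"
  let ?h = "mpow g (p ^ k)"
  have "?h - mat 1 = Q ** (mpow M (p ^ k) - mat 1) ** matrix_inv Q"
  proof -
    have "?h = Q ** mpow M (p ^ k) ** matrix_inv Q"
      using mpow_frame[OF Q(3), of "p ^ k"] matrix_inv_mult(1)[OF Q(1)]
      by (metis matrix_mul_assoc matrix_mul_rid)
    then show ?thesis by (simp add: mat2_diff_distrib matrix_inv_mult(1)[OF Q(1)])
  qed
  moreover have "\<forall>i j. vge v ((Q ** (mpow M (p ^ k) - mat 1) ** matrix_inv Q)$i$j) (e + int k + f)"
    using one_mod_pow_pk[OF p Q(2,4) tM, of k] e f
    by (intro vge_matrix_mult) (auto simp: one_mod_def)
  ultimately have "\<forall>i j. vge v ((?h - mat 1)$i$j) (e + int k + f)" by simp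
  moreover have "N \<le> e + int k + f" by (simp add: k_def)
  ultimately have "\<forall>i j. vge v (?h$i$j - mat 1$i$j) N" by (auto intro: vge_mono)
  then have "?h = mat 1" using N mpow_gen2[OF g(1)] by blast
  then show thesis using that by blast
qed

lemma coprime_orders:
  assumes "mpow h m = mat 1" "mpow h n = mat 1" "coprime m n" "0 < m"
  shows "h = mat 1"
proof -
  obtain x y where "m * x = n * y + 1"
    using bezout_nat[of m n] assms(3,4) by (metis coprime_iff_gcd_eq_1 neq0_conv)
  then have "mpow h (m * x) = mpow h (n * y) ** h" using mpow_add[of h "n * y" 1] by simp
  then show ?thesis by (simp add: mpow_mult assms(1,2))
qed

text \<open>A non-trivial element of p-power order would have a power of order exactly p.\<close>

lemma no_order_p_unipotent:
  assumes p: "residue_char v p"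
    and AB: "det A = 1" "det B = 1" and disc: "discrete_subgroup v (gen2 A B)"
    and no: "\<forall>g\<in>gen2 A B. \<not> has_order g p"
    and g: "g \<in> gen2 A B" "vge v (tr2 g - 2) 1"
  shows "g = mat 1"
proof -
  have pp: "prime p" "vge v (of_nat p) 1" "p > 0"
    using p by (auto simp: residue_char_def prime_gt_0_nat)
  obtain k where k: "mpow g (p ^ k) = mat 1" using unipotent_finite_order[OF pp(2,3) AB disc g] by metis
  have "g \<in> gen2 A B \<Longrightarrow> mpow g (p ^ k) = mat 1 \<Longrightarrow> g = mat 1" for g
  proof (induction k arbitrary: g)
    case (Suc k)
    have "mpow g p = mat 1"
      using Suc.IH[of "mpow g p"] Suc.prems by (simp add: mpow_gen2 mpow_mult)
    moreover have "mpow g m \<noteq> mat 1" if "0 < m" "m < p" "g \<noteq> mat 1" for m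
    proof
      assume "mpow g m = mat 1"
      moreover have "coprime m p" using that pp(1)
        by (metis coprime_commute nat_dvd_not_less prime_imp_coprime)
      ultimately show False using coprime_orders[of g m p] that \<open>mpow g p = mat 1\<close> by blast
    qed
    ultimately show ?case using no Suc.prems(1) pp(3) unfolding has_order_def by blast
  qed simp
  then show ?thesis using g k by blast
qed

text \<open>By Bezout a combination of n and p is 1, so they do not both lie in the maximal
  ideal.\<close>

lemma v_coprime:
  assumes p: "vge v (of_nat p) 1" and "coprime n p"
  shows "(of_nat n :: 'k) \<noteq> 0" "v (of_nat n) = 0"
proof -
  have "\<not> vge v (of_nat n) 1"
  proof
    assume n: "vge v (of_nat n) 1"
    obtain x y where xy: "int n * x + int p * y = 1"
      using assms(2) bezout_int[of "int n" "int p"] by (auto simp: mult.commute)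
    have oi: "vge v (of_int z) 0" for z by (cases z) (auto intro: vge_diff)
    have "(of_nat n :: 'k) * of_int x + of_nat p * of_int y = 1"
      using arg_cong[OF xy, of "of_int :: int \<Rightarrow> 'k"] by simp
    moreover have "vge v ((of_nat n :: 'k) * of_int x + of_nat p * of_int y) 1"
      using n p oi by (intro vge_add vge_mult_right)
    ultimately show False by (simp add: vge_def)
  qed
  then show "(of_nat n :: 'k) \<noteq> 0" "v (of_nat n) = 0" using vge_of_nat[of n] by (auto simp: vge_def)
qed

text \<open>The reason why \<open>SL\<^sub>2(\<rat>\<^sub>p)\<close> has no elements of order \<open>p \<ge> 5\<close>: since \<open>p\<close> divides \<open>(p\<^sup>3 - p)/6\<close>,
  the expansion of \<open>U\<^sub>p\<close> at trace 2 gives \<open>U\<^sub>p \<equiv> p\<close> modulo \<open>\<pi>\<^sup>2\<close>.\<close>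

lemma Qp_unipotent_pow_p:
  assumes Q: "is_Qp v p" and p: "prime p" "p \<ge> 5"
    and g: "det g = 1" "vge v (tr2 g - 2) 1" "mpow g p = mat 1"
  shows "g = mat 1"
proof -
  obtain a b c d where ge: "g = mk2 a b c d" by (rule mat2_cases)
  have 1: "a * d - b * c = 1" using ge g by simp
  have vp: "(of_nat p :: 'k) \<noteq> 0" "v (of_nat p) = 1" using Q by (auto simp: is_Qp_def)
  then have vp1: "vge v (of_nat p) 1" by (simp add: vge_def)
  have co: "coprime n p" if "0 < n" "n < p" for n
    using that p(1) by (metis coprime_commute nat_dvd_not_less prime_imp_coprime)
  have c6: "coprime 6 p"
  proof -
    have "coprime 2 p" "coprime 3 p" using co[of 2] co[of 3] p(2) by auto
    then have "coprime (2 * 3) p" by (simp only: coprime_mult_left_iff)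
    then show ?thesis by simp
  qed
  obtain n where n: "p = Suc n" using p(2) by (cases p) auto
  let ?U = "cheb (a+d)"
  have "vge v (6 * ?U p - 6 * of_nat p - (a + d - 2) * (of_nat p ^ 3 - of_nat p)) 2"
    using cheb_approx2[of "a+d" p] g(2) ge by simp
  moreover have "vge v ((a + d - 2) * (of_nat p ^ 3 - of_nat p)) (1 + 1)"
  proof (intro vge_mult)
    have "vge v (of_nat p * ((of_nat p)\<^sup>2 - 1)) 1"
      using vp1 by (intro vge_mult_right vge_intros) auto
    moreover have "of_nat p * ((of_nat p)\<^sup>2 - 1) = (of_nat p ^ 3 - of_nat p :: 'k)" by algebra
    ultimately show "vge v (of_nat p ^ 3 - of_nat p) 1" by simp
  qed (use g(2) ge in simp)
  ultimately have *: "vge v (6 * ?U p - 6 * of_nat p) 2"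
    using vge_add by (metis diff_add_cancel one_add_one)
  \<comment> \<open>Since 6 is a unit, U_p = 0 would give v(p) \<ge> 2. With U_p non-zero, U_p g -
    U_(p-1) = 1 makes g scalar.\<close>
  have "?U p \<noteq> 0"
  proof
    assume "?U p = 0"
    then have "vge v (6 * of_nat p) 2" using * by simp
    moreover have "(6::'k) \<noteq> 0" "v 6 = 0" using v_coprime[OF vp1 c6] by simp_all
    ultimately show False using vp by (simp add: vge_def v_mult)
  qed
  moreover have "mk2 (?U p * a - ?U n) (?U p * b) (?U p * c) (?U p * d - ?U n) = mat 1"
    using g(3) mpow_cheb[OF 1, of n] ge n by simp
  ultimately have "b = 0" "c = 0" "a = d" by (auto simp: mat_1_mk2) (metis diff_eq_eq mult_left_cancel)
  then have "a = 1 \<or> a = -1" using 1 by (simp add: square_eq_1_iff)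
  moreover have "a \<noteq> -1"
  proof
    assume "a = -1"
    then have "vge v (- of_nat 4) 1" using g(2) ge \<open>a = d\<close> by simp
    moreover have "coprime 4 p" using co[of 4] p(2) by simp
    ultimately show False using v_coprime[OF vp1] by (auto simp: vge_def simp del: of_nat_numeral)
  qed
  ultimately show ?thesis using ge \<open>b = 0\<close> \<open>c = 0\<close> \<open>a = d\<close> by (simp add: mat_1_mk2)
qed

text \<open>Descent from order p^k to order p. The induction needs that trace 2 modulo \<pi> passes
  from g to g^p.\<close>

lemma Qp_unipotent:
  assumes p: "residue_char v p" "is_Qp v p" "p \<ge> 5"
    and AB: "det A = 1" "det B = 1" and disc: "discrete_subgroup v (gen2 A B)"
    and g: "g \<in> gen2 A B" "vge v (tr2 g - 2) 1"
  shows "g = mat 1"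
proof -
  have pp: "prime p" "vge v (of_nat p) 1" "p > 0"
    using p(1) by (auto simp: residue_char_def prime_gt_0_nat)
  obtain k where k: "mpow g (p ^ k) = mat 1" using unipotent_finite_order[OF pp(2,3) AB disc g] by metis
  have "det g = 1 \<Longrightarrow> vge v (tr2 g - 2) 1 \<Longrightarrow> mpow g (p ^ k) = mat 1 \<Longrightarrow> g = mat 1" for g
  proof (induction k arbitrary: g)
    case (Suc k)
    have "vge v (tr2 (mpow g p) - 2) 1"
    proof -
      obtain a b c d where ge: "g = mk2 a b c d" by (rule mat2_cases)
      have 1: "a * d - b * c = 1" using ge Suc.prems by simp
      obtain n where n: "p = Suc n" using pp(3) by (cases p) auto
      let ?U = "cheb (a+d)"
      have t: "vge v (a + d - 2) 1" using Suc.prems(2) ge by simp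
      have i: "vge v (a + d - 2 + 2) 0" by (intro vge_add vge_mono[OF t]) auto
      have "tr2 (mpow g p) - 2
          = (a + d) * (?U p - of_nat p) - 2 * (?U n - of_nat n) + of_nat p * (a + d - 2)"
        unfolding ge n mpow_cheb[OF 1] tr2_mk2 by (simp add: algebra_simps)
      moreover have "vge v \<dots> 1"
        using cheb_approx[OF t, of n] i t n by (intro vge_add[OF vge_diff[OF vge_mult_left vge_mult_left] vge_mult_left])
          (auto intro: vge_add)
      ultimately show ?thesis by (simp only:)
    qed
    then have "mpow g p = mat 1"
      using Suc.IH[of "mpow g p"] Suc.prems by (simp add: det_mpow mpow_mult)
    then show ?case using Qp_unipotent_pow_p[OF p(2) pp(1) p(3)] Suc.prems by blast
  qed simp
  then show ?thesis using g k det_gen2[OF AB] by blast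
qed

end

section \<open>Hensel's lemma for quadratics\<close>

context dval
begin

text \<open>Newton iteration with the slope frozen at \<open>r0\<close>: each step gains one power
  of \<pi>, and only the unit \<open>w\<close> is ever inverted.\<close>

lemma hensel_quadratic:
  assumes compl: "\<And>s. val_cauchy v s \<Longrightarrow> val_converges v s"
    and t: "vge v t 0" and q: "vge v q 0" and r0: "vge v r0 0" "vge v (r0\<^sup>2 - t * r0 + q) 1"
    and u: "2 * r0 - t \<noteq> 0" "v (2 * r0 - t) = 0"
  obtains r where "vge v r 0" "vge v (r - r0) 1" "r\<^sup>2 - t * r + q = 0"
proof -
  define f where "f x = x\<^sup>2 - t * x + q" for x
  define w where "w = 2 * r0 - t"
  have w: "w \<noteq> 0" "v w = 0" using u w_def by auto
  define R where "R n = ((\<lambda>x. x - f x / w) ^^ n) r0" for n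
  have R0: "R 0 = r0" and RS: "R (Suc n) = R n - f (R n) / w" for n by (simp_all add: R_def)
  have inv: "vge v (f (R n)) (int n + 1) \<and> vge v (R n - r0) 1" for n
  proof (induction n)
    case 0
    show ?case using r0 by (simp add: R0 f_def)
  next
    case (Suc n)
    define h where "h = f (R n) / w"
    have h: "vge v h (int n + 1)" unfolding h_def using vge_divide[of "f (R n)" "int n + 1" w] Suc w by simp
    have Rh: "R (Suc n) = R n - h" by (simp add: RS h_def)
    have "f (R (Suc n)) = f (R n) - h * (2 * R n - t) + h * h"
      unfolding Rh f_def by (simp add: power2_eq_square algebra_simps)
    also have "f (R n) = h * w" using w by (simp add: h_def)
    also have "h * w - h * (2 * R n - t) + h * h = h * h - 2 * (h * (R n - r0))"
      unfolding w_def by (simp add: algebra_simps)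
    finally have e: "f (R (Suc n)) = h * h - 2 * (h * (R n - r0))" .
    have "vge v (h * h) (int n + 1 + (int n + 1))" by (intro vge_mult h)
    then have 1: "vge v (h * h) (int n + 1 + 1)" by (rule vge_mono) simp
    have 2: "vge v (h * (R n - r0)) (int n + 1 + 1)" using Suc by (intro vge_mult h) auto
    have "vge v (h * h - 2 * (h * (R n - r0))) (int n + 1 + 1)"
      by (intro vge_diff[OF 1 vge_mult_left[OF _ 2]]) simp
    then have "vge v (f (R (Suc n))) (int (Suc n) + 1)" using e by (simp add: add_ac)
    moreover have "vge v (R n - r0 - h) 1" using Suc h by (intro vge_diff[of "R n - r0"]) (auto elim: vge_mono)
    ultimately show ?case by (simp add: RS h_def[symmetric] algebra_simps)
  qed
  have step: "vge v (R (M + n) - R M) (int M + 1)" for M n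
  proof (induction n)
    case (Suc n)
    have "vge v (f (R (M + n)) / w) (int M + 1)"
      using vge_divide[of "f (R (M + n))" "int (M + n) + 1" w] inv[of "M + n"] w by (auto intro: vge_mono)
    then have "vge v (R (M + n) - R M - f (R (M + n)) / w) (int M + 1)" using Suc by (rule vge_diff[rotated])
    then show ?case by (simp add: RS algebra_simps)
  qed simp
  have "val_cauchy v R" unfolding val_cauchy_def
  proof
    fix N :: int
    have "vge v (R m - R n) N" if "m \<ge> nat N" "n \<ge> nat N" for m n
    proof -
      have "vge v (R m - R (nat N)) (int (nat N) + 1)" "vge v (R n - R (nat N)) (int (nat N) + 1)"
        using step[of "nat N" "m - nat N"] step[of "nat N" "n - nat N"] that by simp_all
      then have "vge v (R m - R (nat N) - (R n - R (nat N))) (int (nat N) + 1)" by (rule vge_diff)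
      then have "vge v (R m - R n) (int (nat N) + 1)" by simp
      then show ?thesis by (rule vge_mono) simp
    qed
    then show "\<exists>M. \<forall>m\<ge>M. \<forall>n\<ge>M. vge v (R m - R n) N" by blast
  qed
  then obtain r where r: "\<And>N. \<exists>M. \<forall>n\<ge>M. vge v (R n - r) N" using compl unfolding val_converges_def by blast
  have Ri: "vge v (R n) 0" for n
    using vge_add[of "R n - r0" 0 r0] vge_mono[of "R n - r0" 1 0] inv[of n] r0 by simp
  obtain M where "vge v (R M - r) 1" using r[of 1] by blast
  then have rr0: "vge v (r - r0) 1"
    using vge_diff[of "R M - r0" 1 "R M - r"] inv[of M] by simp
  then have ri: "vge v r 0" using vge_add[of "r - r0" 0 r0] vge_mono[of "r - r0" 1 0] r0 by simp
  have "f r = 0"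
  proof (rule vge_all_imp_0)
    fix N
    obtain M where M: "\<forall>n\<ge>M. vge v (R n - r) N" using r[of N] by blast
    define n where "n = max M (nat N)"
    have "f r = f (R n) - (R n - r) * (R n + r - t)" unfolding f_def by (simp add: power2_eq_square algebra_simps)
    moreover have "vge v (f (R n)) N" using inv[of n] n_def by (auto elim: vge_mono)
    moreover have "vge v (R n - r) N" using M n_def by auto
    then have "vge v ((R n - r) * (R n + r - t)) N"
      by (rule vge_mult_right) (intro vge_diff vge_add Ri ri t)
    ultimately show "vge v (f r) N" by (simp only: vge_diff)
  qed
  then show thesis using that ri rr0 f_def by simp
qed

text \<open>Substituting x = t y turns the characteristic polynomial into t^2 (y^2 - y + 1/t^2),
  which has the simple root y = 1 modulo \<pi>.\<close>

lemma hyperbolic_diagonal: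
  assumes compl: "\<And>s. val_cauchy v s \<Longrightarrow> val_converges v s"
    and "det B = 1" "tr2 B \<noteq> 0" "v (tr2 B) < 0"
  obtains P l m where "det P \<noteq> 0" "B ** P = P ** mk2 l 0 0 m"
proof -
  let ?t = "tr2 B"
  have q: "vge v (1 / ?t\<^sup>2) 1" using assms by (simp add: vge_def v_divide v_power)
  obtain y where y: "vge v (y - 1) 1" "y\<^sup>2 - 1 * y + 1 / ?t\<^sup>2 = 0"
    by (rule hensel_quadratic[OF compl, of 1 "1 / ?t\<^sup>2" 1]) (use q in \<open>auto elim: vge_mono\<close>)
  define l where "l = ?t * y"
  define m where "m = ?t - l"
  have "y * (1 - y) = 1 / ?t\<^sup>2" using y(2) by (simp add: power2_eq_square algebra_simps)
  then have "?t\<^sup>2 * (y * (1 - y)) = 1" using assms(3) by simp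
  then have lm: "l * m = 1" unfolding l_def m_def by (simp add: power2_eq_square algebra_simps)
  have "l \<noteq> m"
  proof
    assume "l = m"
    then have "l * l = 1" using lm by simp
    then have "l = 1 \<or> l = -1" by (simp add: square_eq_1_iff)
    then have "vge v (l + m) 0" using \<open>l = m\<close> by (auto intro!: vge_add)
    then show False using assms by (simp add: m_def vge_def)
  qed
  then show thesis using diagonal_frame[OF assms(2) lm] that m_def by auto
qed

text \<open>A scalar matrix acts trivially on the tree, and \<open>B\<close> alone fixes a vertex
  or, by its eigenvector, an end.\<close>

lemma elementary_central:
  assumes compl: "\<And>s. val_cauchy v s \<Longrightarrow> val_converges v s"
    and B: "det B = 1" and A: "A = mk2 e 0 0 e" "det A = 1"
  shows "elementary v (gen2 A B)"
proof (cases "vge v (tr2 B) 0")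
  case True
  obtain Q M where Q: "det Q \<noteq> 0" "det M = 1" "B ** Q = Q ** M" "int2 M"
    using integral_trace_imp_fix[OF B True] by metis
  have "e = 1 \<or> e = -1" using SL2_scalar A by simp
  then have "int2 A" using A by auto
  moreover have "A ** Q = Q ** A" using A smat_commute[of e] by (simp add: smat_def)
  ultimately show ?thesis using elementary_vertex[OF A(2) B Q(1)] Q by blast
next
  case False
  then obtain P l m where P: "det P \<noteq> 0" "B ** P = P ** mk2 l 0 0 m"
    using hyperbolic_diagonal[OF compl B] not_vge by metis
  moreover have "A ** P = P ** mk2 e 0 0 e" using A smat_commute[of e P] by (simp add: smat_def)
  ultimately show ?thesis using elementary_eigenvector[OF A(2) B] by blast
qed

section \<open>No root of the characteristic polynomial modulo \<open>\<pi>\<^sup>2\<close>\<close>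

text \<open>Divide by the square of the variable of least valuation, say z: the quotient is a value
  of f at an integral point, so it does not have valuation 2 or more. Hence 2n - 2 v(z) < 2, that
  is, n \<le> v(z).\<close>

lemma norm_form_bound:
  assumes an: "\<And>l. vge v l 0 \<Longrightarrow> \<not> vge v (l\<^sup>2 - t * l + 1) 2"
    and N: "vge v (x\<^sup>2 - t * x * z + z\<^sup>2) (2 * n)"
  shows "vge v x n \<and> vge v z n"
proof -
  have main: "vge v x n \<and> vge v z n"
    if N: "vge v (x\<^sup>2 - t * x * z + z\<^sup>2) (2 * n)" and z: "z \<noteq> 0" "vge v x (v z)" for x z
  proof -
    have l: "vge v (x / z) 0" using vge_divide[OF z(2,1)] by simp
    have "x\<^sup>2 - t * x * z + z\<^sup>2 = z\<^sup>2 * ((x / z)\<^sup>2 - t * (x / z) + 1)"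
      using z by (simp add: field_simps power2_eq_square)
    then have "vge v ((x / z)\<^sup>2 - t * (x / z) + 1) (2 * n - 2 * v z)"
      using N z by (simp add: vge_mult_cancel v_power)
    then have "n \<le> v z" using an[OF l] vge_mono[of _ "2 * n - 2 * v z" 2] by fastforce
    then show ?thesis using z by (auto simp: vge_def)
  qed
  consider "x = 0 \<and> z = 0" | "z \<noteq> 0 \<and> vge v x (v z)" | "x \<noteq> 0 \<and> vge v z (v x)"
    unfolding vge_def by (metis linear)
  then show ?thesis
  proof cases
    case 3
    have "z\<^sup>2 - t * z * x + x\<^sup>2 = x\<^sup>2 - t * x * z + z\<^sup>2" by (simp add: algebra_simps)
    then have "vge v (z\<^sup>2 - t * z * x + x\<^sup>2) (2 * n)" using N by (simp only:)
    then show ?thesis using main[of z x] 3 by blast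
  qed (use main[OF N] in auto)
qed

text \<open>Integrality of the commutator trace makes \<open>x\<close> and \<open>z\<close>
  integral, and det B = 1 then bounds v(c) and v(d) by -1 from below. Either \<open>B'\<close> is
  integral and \<open>Q\<close> gives a common fixed vertex, or its neighbour \<open>Q ** S\<close>
  does.\<close>

lemma anisotropic_case:
  assumes A: "det A = 1" and B: "det B = 1" and t: "vge v (tr2 A) 0"
    and an: "\<And>l. vge v l 0 \<Longrightarrow> \<not> vge v (l\<^sup>2 - tr2 A * l + 1) 2"
    and g: "vge v (tr2 (comm2 A B) - 2) 0"
  shows "elementary v (gen2 A B)"
proof -
  define T where "T = tr2 A"
  note t = t[folded T_def] and an = an[folded T_def]
  have "A \<noteq> mk2 x 0 0 x" for x
  proof
    assume *: "A = mk2 x 0 0 x"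
    then have "x = 1 \<or> x = -1" using SL2_scalar A by simp
    then have "vge v x 0" "x\<^sup>2 - T * x + 1 = 0" using * by (auto simp: T_def)
    then show False using an[of x] by simp
  qed
  then obtain Q where Q: "det Q \<noteq> 0" "A ** Q = Q ** mk2 0 (-1) 1 T"
    using companion_frame[OF A] T_def by metis
  obtain B' where B': "B ** Q = Q ** B'" "det B' = 1" using frame_exists[OF Q(1)] B by metis
  obtain a b c d where Be: "B' = mk2 a b c d" by (rule mat2_cases)
  have 1: "a * d - b * c = 1" using B' Be by simp
  define x where "x = b + c"
  define z where "z = a - d + T * c"
  have ad: "a = d - T * c + z" and bc: "b = x - c" by (simp_all add: x_def z_def)
  have "tr2 (comm2 A B) - 2 = x\<^sup>2 - T * x * z + z\<^sup>2"
    unfolding tr2_comm2[OF A B] det_commutator_frame[OF Q B'(1)]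
    by (simp add: Be ad bc power2_eq_square algebra_simps)
  then have xz: "vge v x 0" "vge v z 0"
    using norm_form_bound[OF an, of x z 0] g by auto
  \<comment> \<open>This is det B' = 1, written with the same norm form; the right side is only
    linear in \<open>c\<close> and \<open>d\<close>, which drives the descent below.\<close>
  have N: "d\<^sup>2 - T * d * c + c\<^sup>2 = 1 - z * d + x * c"
    using 1 unfolding ad bc by (simp add: power2_eq_square algebra_simps)
  have Nn: "vge v d n \<Longrightarrow> vge v c n \<Longrightarrow> n \<le> 0 \<Longrightarrow> vge v (d\<^sup>2 - T * d * c + c\<^sup>2) n" for n
    unfolding N using xz vge_mono[OF vge_1, of n]
    by (intro vge_add[OF vge_diff[OF _ vge_mult_left] vge_mult_left]) auto
  have dc1: "vge v d (-1) \<and> vge v c (-1)"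
  proof -
    have bound: "vge v d (- int n) \<Longrightarrow> vge v c (- int n) \<Longrightarrow> vge v d (-1) \<and> vge v c (-1)" for n
    proof (induction n rule: less_induct)
      case (less n)
      show ?case
      proof (cases "n \<le> 1")
        case True
        then show ?thesis using less.prems by (auto elim: vge_mono)
      next
        case False
        \<comment> \<open>Half of n, rounded up: a value of the norm form of valuation at least -n
          has arguments of valuation at least -m. The descent stalls at n = 1.\<close>
        define m where "m = nat ((int n + 1) div 2)"
        have m: "m < n" "2 * (- int m) \<le> - int n" using False by (auto simp: m_def)
        have "vge v (d\<^sup>2 - T * d * c + c\<^sup>2) (- int n)" by (rule Nn) (use less.prems in auto)
        then have "vge v (d\<^sup>2 - T * d * c + c\<^sup>2) (2 * (- int m))" using m(2) by (rule vge_mono)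
        from norm_form_bound[OF an this] show ?thesis using less.IH[OF m(1)] by blast
      qed
    qed
    define n where "n = nat (max (- v d) (- v c))"
    show ?thesis by (rule bound[of n]) (auto simp: n_def vge_def)
  qed
  have iA: "int2 (mk2 0 (-1) 1 T)" using t by simp
  show ?thesis
  proof (cases "vge v c 0 \<and> vge v d 0")
    case True
    then have "int2 B'" using xz t unfolding Be int2_mk2 ad bc by (auto intro!: vge_intros)
    then show ?thesis using elementary_vertex[OF A B Q(1,2) iA B'(1)] by blast
  next
    case False
    have Nm1: "vge v (d\<^sup>2 - T * d * c + c\<^sup>2) (-1)" using dc1 by (intro Nn) auto
    have c: "c \<noteq> 0" "v c = -1"
    proof -
      \<comment> \<open>Otherwise d^2 would be the only term of valuation -2.\<close>
      have "\<not> vge v c 0"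
      proof
        assume c0: "vge v c 0"
        then have d: "d \<noteq> 0" "v d = -1" using False dc1 by (auto simp: vge_def)
        have "vge v (T * d * c) (0 + -1 + 0)" using d t c0 by (intro vge_mult) (auto simp: vge_def)
        then have Tdc: "vge v (T * d * c) (-1)" by simp
        have "vge v (c\<^sup>2) (-1)" using vge_power0[OF c0, of 2] by (rule vge_mono) simp
        then have "vge v (d\<^sup>2 - T * d * c + c\<^sup>2 - c\<^sup>2 + T * d * c) (-1)"
          by (rule vge_add[OF vge_diff[OF Nm1] Tdc])
        then show False using d by (simp add: vge_square)
      qed
      then show "c \<noteq> 0" "v c = -1" using dc1 by (auto simp: vge_def)
    qed
    define l where "l = d / c"
    have d: "d = l * c" using c by (simp add: l_def)
    have l: "vge v l 0" using vge_divide[of d "-1" c] dc1 c by (simp add: l_def)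
    define f where "f = l\<^sup>2 - T * l + 1"
    have Nf: "d\<^sup>2 - T * d * c + c\<^sup>2 = c\<^sup>2 * f" unfolding f_def d by (simp add: power2_eq_square algebra_simps)
    have f1: "vge v f 1" using Nm1 c unfolding Nf by (simp add: vge_mult_cancel v_power)
    define u where "u = 2 * l - T"
    have iu: "vge v u 0" unfolding u_def using l t by (intro vge_intros) auto
    \<comment> \<open>\<open>u\<close> is f'(l). If it were a unit, one Newton step would produce a
      root modulo \<pi>^2; so l is a double root modulo \<pi>.\<close>
    have u1: "vge v u 1"
    proof (rule ccontr)
      assume "\<not> vge v u 1"
      then have u: "u \<noteq> 0" "v u = 0" using iu by (auto simp: vge_def)
      define h where "h = f / u"
      have h: "vge v h 1" using vge_divide[OF f1 u(1)] u by (simp add: h_def)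
      have "(l - h)\<^sup>2 - T * (l - h) + 1 = f - h * u + h * h"
        unfolding f_def u_def by (simp add: power2_eq_square algebra_simps)
      also have "\<dots> = h * h" using u by (simp add: h_def)
      finally have "vge v ((l - h)\<^sup>2 - T * (l - h) + 1) (1 + 1)" using vge_mult[OF h h] by simp
      moreover have "vge v (l - h) 0" using l h by (intro vge_diff) (auto elim: vge_mono)
      ultimately show False using an by simp
    qed
    obtain \<pi> where \<pi>: "\<pi> \<noteq> 0" "v \<pi> = 1" by (rule uniformizer)
    \<comment> \<open>(-1, l) is an eigenvector of the companion matrix modulo \<pi>. Together with
      \<pi> O^2 it spans an invariant lattice adjacent to O^2.\<close>
    define S where "S = mk2 (-1) 0 l \<pi>"
    have frame: "mk2 a' b' c' d' ** S
       = S ** mk2 (a' - b' * l) (- b' * \<pi>) ((l * (b' * l - a') - c' + d' * l) / \<pi>) (l * b' + d')"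
      for a' b' c' d'
      unfolding S_def using \<pi> by (simp add: field_simps)
    have dP: "det (Q ** S) \<noteq> 0" using Q \<pi> by (simp add: det_mul S_def)
    let ?A = "mk2 l \<pi> ((- f) / \<pi>) (T - l)"
    have "mk2 0 (-1) 1 T ** S = S ** ?A"
      unfolding frame by (simp add: f_def power2_eq_square algebra_simps)
    then have fA: "A ** (Q ** S) = Q ** S ** ?A" using Q(2) by (metis matrix_mul_assoc)
    have iA: "int2 ?A"
    proof -
      have "vge v ((- f) / \<pi>) (1 - v \<pi>)" using f1 \<pi> by (intro vge_divide) auto
      then have "vge v ((- f) / \<pi>) 0" using \<pi> by simp
      moreover have "vge v \<pi> 0" using \<pi> by (simp add: vge_def)
      ultimately show ?thesis using l t by (auto intro: vge_diff)
    qed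
    let ?k = "l * (b * l - a) - c + d * l"
    let ?B = "mk2 (a - b * l) (- b * \<pi>) (?k / \<pi>) (l * b + d)"
    have fB: "B ** (Q ** S) = Q ** S ** ?B" using B'(1) frame[of a b c d] Be by (metis matrix_mul_assoc)
    have iB: "int2 ?B"
    proof -
      have cu: "vge v (c * u) 0" using vge_mult[of c "-1" u 1] u1 c by (simp add: vge_def)
      have "a - b * l = c * u + z - x * l" unfolding ad bc d u_def by (simp add: algebra_simps)
      moreover have "vge v \<dots> 0" by (rule vge_diff[OF vge_add[OF cu xz(2)] vge_mult0[OF xz(1) l]])
      ultimately have 1: "vge v (a - b * l) 0" by (simp only:)
      have "vge v b (-1)" unfolding bc using c xz(1) by (intro vge_diff) (auto elim: vge_mono simp: vge_def)
      then have 2: "vge v (- b * \<pi>) 0" using vge_mult[of b "-1" \<pi> 1] \<pi> by (simp add: vge_def)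
      have "l * b + d = l * x" unfolding bc d by (simp add: algebra_simps)
      then have 4: "vge v (l * b + d) 0" using l xz by (simp only: vge_mult0)
      \<comment> \<open>The equation \<open>N\<close> after d = l c. As v(1 / c) = 1, it provides
        the factor \<pi> needed in \<open>?k\<close>.\<close>
      have "c * (c * f + z * l - x) = 1"
        using N unfolding d f_def by (simp add: power2_eq_square algebra_simps)
      then have cf: "c * f + z * l - x = 1 / c" using c by (simp add: field_simps)
      have "?k = - (c * f + z * l - x) - x * (f - l * u)"
        unfolding ad bc d f_def u_def by (simp add: power2_eq_square algebra_simps)
      also have "\<dots> = - (1 / c) - x * (f - l * u)" unfolding cf ..
      also have "vge v \<dots> 1"
      proof (intro vge_diff[OF _ vge_mult_left[OF xz(1)]])
        show "vge v (- (1 / c)) 1" using c by (simp add: vge_def v_divide)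
        show "vge v (f - l * u) 1" by (rule vge_diff[OF f1 vge_mult_left[OF l u1]])
      qed
      finally have "vge v (?k / \<pi>) (1 - v \<pi>)" using \<pi> by (intro vge_divide) auto
      then show ?thesis using 1 2 4 \<pi> by simp
    qed
    show ?thesis by (rule elementary_vertex[OF A B dP fA iA fB iB])
  qed
qed

end

section \<open>Residue classes and traces of finite-order elements\<close>

context dval
begin

lemma residue_classes_le:
  assumes fin: "finite (residue_field v)" and S: "finite S" "S \<subseteq> val_ring v"
    and inc: "\<And>x y. x \<in> S \<Longrightarrow> y \<in> S \<Longrightarrow> vge v (x - y) 1 \<Longrightarrow> x = y"
  shows "card S \<le> card (residue_field v)"
proof (rule card_inj_on_le[OF _ _ fin])
  have refl: "(x, x) \<in> res_rel v" if "x \<in> val_ring v" for x using that by (simp add: res_rel_def)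
  show "inj_on (\<lambda>x. res_rel v `` {x}) S"
  proof (rule inj_onI)
    fix x y assume xy: "x \<in> S" "y \<in> S" "res_rel v `` {x} = res_rel v `` {y}"
    then have "(x, y) \<in> res_rel v" using refl[of y] S by blast
    then show "x = y" using inc xy by (simp add: res_rel_def)
  qed
  show "(\<lambda>x. res_rel v `` {x}) ` S \<subseteq> residue_field v"
    using S by (auto simp: residue_field_def quotient_def)
qed

lemma residue_pigeonhole:
  assumes fin: "finite (residue_field v)" and l: "vge v l 0"
  obtains i j :: nat where "i < j" "vge v (l ^ i - l ^ j) 1"
proof -
  let ?f = "\<lambda>i::nat. res_rel v `` {l ^ i}"
  have li: "l ^ i \<in> val_ring v" for i using l by (simp add: val_ring_def vge_power0)
  have "range ?f \<subseteq> residue_field v" using li by (auto simp: residue_field_def quotient_def)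
  then have "\<not> inj ?f" using fin finite_subset finite_imageD infinite_UNIV_nat by blast
  then obtain i j where ij: "i \<noteq> j" "?f i = ?f j" by (auto simp: inj_on_def)
  have "(l ^ j, l ^ j) \<in> res_rel v" using li by (simp add: res_rel_def)
  then have "(l ^ i, l ^ j) \<in> res_rel v" using ij(2) by blast
  then have ge: "vge v (l ^ i - l ^ j) 1" by (simp add: res_rel_def)
  then have ge': "vge v (l ^ j - l ^ i) 1" using vge_uminus[of "l ^ i - l ^ j" 1] by simp
  show thesis using that[of i j] that[of j i] ij(1) ge ge' by (cases "i < j") auto
qed

text \<open>As g^2 = (tr g) g - 1, a scalar square means that g is scalar or has trace 0. If g^2 has
  trace 0, then (tr g)^2 = 2, which has odd valuation.\<close>

lemma dyadic_order:
  assumes two: "(2::'k) \<noteq> 0" "v 2 = 1"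
  shows "det (g :: 'k^2^2) = 1 \<Longrightarrow> mpow g (2 ^ k) = mat 1 \<Longrightarrow> (\<exists>e. g = mk2 e 0 0 e) \<or> tr2 g = 0"
proof (induction k arbitrary: g)
  case 0
  then show ?case by (auto simp: mat_1_mk2)
next
  case (Suc k)
  obtain a b c d where g: "g = mk2 a b c d" by (rule mat2_cases)
  have 1: "a * d - b * c = 1" using Suc.prems g by simp
  have "mpow (mpow g 2) (2 ^ k) = mat 1" using Suc.prems by (simp add: mpow_mult[symmetric])
  then have "(\<exists>e. mpow g 2 = mk2 e 0 0 e) \<or> tr2 (mpow g 2) = 0"
    using Suc.IH[of "mpow g 2"] Suc.prems by (simp add: det_mpow)
  then show ?case
  proof
    assume "\<exists>e. mpow g 2 = mk2 e 0 0 e"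
    then have "(a + d) * b = 0" "(a + d) * c = 0" "(a + d) * a = (a + d) * d"
      using mpow_2_mk2[OF 1] g by auto
    then have "a + d = 0 \<or> b = 0 \<and> c = 0 \<and> a = d" by auto
    then show ?thesis using g by auto
  next
    assume "tr2 (mpow g 2) = 0"
    then have sq: "(tr2 g)\<^sup>2 = 2" using tr2_mpow_2[of g] Suc.prems by simp
    then have "tr2 g \<noteq> 0" using two by auto
    then have "2 * v (tr2 g) = 1" using v_power[of "tr2 g" 2] sq two by simp
    then show ?thesis by presburger
  qed
qed

text \<open>The descent uses g^3 = (t^2 - 1) g - t: a scalar cube means g scalar or t^2 = 1. The
  factor 2 in the exponent admits -1 at the bottom.\<close>

lemma triadic_order:
  assumes three: "(3::'k) \<noteq> 0" "v 3 = 1" and two: "(2::'k) \<noteq> 0"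
  shows "det (g :: 'k^2^2) = 1 \<Longrightarrow> mpow g (2 * 3 ^ k) = mat 1 \<Longrightarrow> (\<exists>e. g = mk2 e 0 0 e) \<or> (tr2 g)\<^sup>2 = 1"
proof (induction k arbitrary: g)
  case 0
  then show ?case using mpow_2_eq_1[of g] two by (auto simp: mat_1_mk2)
next
  case (Suc k)
  obtain a b c d where g: "g = mk2 a b c d" by (rule mat2_cases)
  have 1: "a * d - b * c = 1" using Suc.prems g by simp
  define t where "t = a + d"
  have m3: "mpow g 3 = mk2 ((t\<^sup>2-1)*a-t) ((t\<^sup>2-1)*b) ((t\<^sup>2-1)*c) ((t\<^sup>2-1)*d-t)"
    using mpow_3_mk2[OF 1] g t_def by simp
  have "mpow (mpow g 3) (2 * 3 ^ k) = mat 1"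
    using Suc.prems by (simp add: mpow_mult[symmetric] mult.left_commute)
  then have "(\<exists>e. mpow g 3 = mk2 e 0 0 e) \<or> (tr2 (mpow g 3))\<^sup>2 = 1"
    using Suc.IH[of "mpow g 3"] Suc.prems by (simp add: det_mpow)
  then show ?case
  proof
    assume "\<exists>e. mpow g 3 = mk2 e 0 0 e"
    then have "(t\<^sup>2-1) * b = 0" "(t\<^sup>2-1) * c = 0" "(t\<^sup>2-1) * a = (t\<^sup>2-1) * d"
      using m3 by auto
    then have "t\<^sup>2 - 1 = 0 \<or> b = 0 \<and> c = 0 \<and> a = d" by (metis mult_eq_0_iff mult_left_cancel)
    then show ?thesis using g t_def by auto
  next
    assume "(tr2 (mpow g 3))\<^sup>2 = 1"
    define e where "e = tr2 (mpow g 3)"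
    have e: "e\<^sup>2 = 1" "e = 1 \<or> e = -1"
      using \<open>(tr2 (mpow g 3))\<^sup>2 = 1\<close> by (simp_all add: e_def power2_eq_1_iff)
    have et: "e = t ^ 3 - 3 * t"
      unfolding e_def m3 tr2_mk2 t_def by (simp add: power2_eq_square power3_eq_cube algebra_simps)
    \<comment> \<open>Centred at \<open>e\<close>, the equation \<open>t\<^sup>3 - 3t = e\<close> is Eisenstein, hence has no solution.\<close>
    define u where "u = t - e"
    have "u ^ 3 = 3 * (e - e * u\<^sup>2) + (e\<^sup>2 - 1) * (2 * e - 3 * t)"
      using et unfolding u_def by algebra
    then have u: "u ^ 3 = 3 * (e - e * u\<^sup>2)" using e by simp
    have ve: "v e = 0" "e \<noteq> 0" using e(2) by auto
    have u0: "u \<noteq> 0" using u three ve by auto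
    show ?thesis
    proof (cases "v u \<le> 0")
      case True
      have "vge v (e - e * u\<^sup>2) (2 * v u)"
        using True ve u0 by (intro vge_diff) (auto simp: vge_def v_mult v_power)
      moreover have "vge v 3 1" using three by (simp add: vge_def)
      ultimately have "vge v (u ^ 3) (1 + 2 * v u)" unfolding u by (intro vge_mult)
      then show ?thesis using u0 True by (simp add: vge_def v_power)
    next
      case False
      have "vge v (3 * e * u\<^sup>2) (1 + 0 + 2)"
        by (intro vge_mult) (use three ve u0 False in \<open>auto simp: vge_def v_power\<close>)
      moreover have "vge v (u ^ 3) 3" using u0 False by (simp add: vge_def v_power)
      ultimately have "vge v (u ^ 3 + 3 * e * u\<^sup>2) 3" by (intro vge_add) simp_all
      moreover have "u ^ 3 + 3 * e * u\<^sup>2 = 3 * e" unfolding u by (simp add: algebra_simps)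
      ultimately show ?thesis using three ve by (simp add: vge_def v_mult)
    qed
  qed
qed

end

section \<open>Discrete non-elementary groups under the hypothesis on p\<close>

locale discrete_setting = dval v for v :: "'k::field \<Rightarrow> int" +
  fixes p :: nat and A B :: "'k^2^2"
  assumes compl: "\<And>s. val_cauchy v s \<Longrightarrow> val_converges v s"
    and fin: "finite (residue_field v)"
    and p: "residue_char v p"
    and A: "det A = 1" and B: "det B = 1"
    and disc: "discrete_subgroup v (gen2 A B)"
    and nonel: "\<not> elementary v (gen2 A B)"
    and hyp: "is_Qp v p \<or> (\<forall>g\<in>gen2 A B. \<not> has_order g p)"
begin

lemma prime_p: "prime p" "p > 0" and vp: "vge v (of_nat p) 1"
  using p by (auto simp: residue_char_def prime_gt_0_nat)

lemma unipotent_trivial: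
  assumes "\<not> (is_Qp v p \<and> (p = 2 \<or> p = 3))" "g \<in> gen2 A B" "vge v (tr2 g - 2) 1"
  shows "g = mat 1"
proof (cases "is_Qp v p")
  case True
  have "p \<noteq> 4" using prime_p(1) by auto
  then have "p \<ge> 5" using True assms(1) prime_ge_2_nat[OF prime_p(1)] by auto
  then show ?thesis using Qp_unipotent[OF p True _ A B disc assms(2,3)] by blast
next
  case False
  then show ?thesis using no_order_p_unipotent[OF p A B disc _ assms(2,3)] hyp by blast
qed

lemma A_noncentral: "A \<noteq> mk2 e 0 0 e"
  using elementary_central[OF compl B _ A] nonel by blast

text \<open>The element A^2 has trace 2 modulo \<pi>. Away from Q_2 and Q_3 it is therefore trivial,
  and A is central or of order 2 = p. For Q_2 the trace of A must be 0, for Q_3 its square must be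
  1.\<close>

lemma unipotent_case:
  assumes t: "vge v ((tr2 A)\<^sup>2 - 4) 1" and l: "vge v l 0" "vge v (l\<^sup>2 - tr2 A * l + 1) 2"
  shows False
proof -
  have A2: "mpow A 2 \<in> gen2 A B" "vge v (tr2 (mpow A 2) - 2) 1"
    using t by (simp_all add: mpow_gen2 gen_A tr2_mpow_2[OF A])
  show False
  proof (cases "is_Qp v p \<and> (p = 2 \<or> p = 3)")
    case False
    then have 1: "mpow A 2 = mat 1" using unipotent_trivial A2 by blast
    have ne: "A \<noteq> mat 1" using A_noncentral[of 1] by (simp add: mat_1_mk2)
    show False
    proof (cases "p = 2")
      case True
      have "mpow A m \<noteq> mat 1" if "0 < m \<and> m < 2" for m
      proof -
        have "m = Suc 0" using that by simp
        then show ?thesis using ne by simp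
      qed
      then have "has_order A p" using 1 True by (simp add: has_order_def)
      then show False using hyp False True gen_A[of A B] by blast
    next
      case False
      then have "coprime 2 p" using prime_p(1) two_is_prime_nat primes_coprime by metis
      then have "(2::'k) \<noteq> 0" using v_coprime[OF vp, of 2] by simp
      then show False using mpow_2_eq_1[OF A 1] ne A_noncentral[of "-1"] by blast
    qed
  next
    case True
    obtain k where k: "mpow (mpow A 2) (p ^ k) = mat 1"
      using unipotent_finite_order[OF vp prime_p(2) A B disc A2] by metis
    have vp1: "(of_nat p :: 'k) \<noteq> 0" "v (of_nat p) = 1" using True by (auto simp: is_Qp_def)
    show False
    proof (cases "p = 2")
      case p2: True
      have two: "(2::'k) \<noteq> 0" "v 2 = 1" using vp1 p2 by simp_all
      have "mpow A (2 ^ Suc k) = mat 1" using k p2 by (simp add: mpow_mult[symmetric])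
      then have "tr2 A = 0" using dyadic_order[OF two A] A_noncentral by blast
      \<comment> \<open>-1 is not a square modulo 4: (l - 1)^2 has positive, hence even, valuation
        at least 2, which puts 2l in \<pi>^2 and l in \<pi>.\<close>
      then have f: "vge v (l\<^sup>2 + 1) 2" using l by simp
      have e: "(l - 1)\<^sup>2 = l\<^sup>2 + 1 - 2 * l" by (simp add: power2_eq_square algebra_simps)
      have "vge v (2 * l) 1" using two l by (intro vge_mult_right) (auto simp: vge_def)
      then have "vge v ((l - 1)\<^sup>2) 1" unfolding e using vge_mono[OF f, of 1] by (intro vge_diff[of "l\<^sup>2 + 1"]) auto
      then have "vge v ((l - 1)\<^sup>2) 2" by (auto simp: vge_square)
      then have "vge v (l\<^sup>2 + 1 - (l - 1)\<^sup>2) 2" by (rule vge_diff[OF f])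
      then have "vge v (2 * l) 2" by (simp add: e)
      then have "vge v l 1" using two by (simp add: vge_mult_cancel)
      then have "vge v (l\<^sup>2) 1" by (cases "l = 0") (auto simp: vge_def v_power)
      then have "vge v (l\<^sup>2 + 1 - l\<^sup>2) 1" using vge_mono[OF f, of 1] by (intro vge_diff[of "l\<^sup>2 + 1"]) auto
      then show False by (simp add: vge_def)
    next
      case False
      then have p3: "p = 3" using True by blast
      have three: "(3::'k) \<noteq> 0" "v 3 = 1" using vp1 p3 by simp_all
      have two: "(2::'k) \<noteq> 0" using v_coprime[OF vp, of 2] p3 by simp
      have "mpow A (2 * 3 ^ k) = mat 1" using k p3 by (simp add: mpow_mult[symmetric])
      then have t1: "(tr2 A)\<^sup>2 = 1" using triadic_order[OF three two A] A_noncentral by blast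
      \<comment> \<open>Completing the square: -3 is not a square modulo 9, because a square
        divisible by 3 is divisible by 9.\<close>
      have "4 * (l\<^sup>2 - tr2 A * l + 1) = (2 * l - tr2 A)\<^sup>2 - (tr2 A)\<^sup>2 + 4"
        by (simp add: power2_eq_square algebra_simps)
      also have "\<dots> = (2 * l - tr2 A)\<^sup>2 + 3" by (simp add: t1)
      finally have f4: "4 * (l\<^sup>2 - tr2 A * l + 1) = (2 * l - tr2 A)\<^sup>2 + 3" .
      have f: "vge v ((2 * l - tr2 A)\<^sup>2 + 3) 2"
        unfolding f4[symmetric] by (rule vge_mult_left[OF vge_numeral l(2)])
      have "vge v ((2 * l - tr2 A)\<^sup>2 + 3 - 3) 1"
        using vge_mono[OF f, of 1] three by (intro vge_diff[of "(2 * l - tr2 A)\<^sup>2 + 3"]) (auto simp: vge_def)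
      then have "vge v ((2 * l - tr2 A)\<^sup>2) 2" by (auto simp: vge_square)
      then have "vge v ((2 * l - tr2 A)\<^sup>2 + 3 - (2 * l - tr2 A)\<^sup>2) 2" by (rule vge_diff[OF f])
      then show False using three by (simp add: vge_def)
    qed
  qed
qed

end

section \<open>Split elements\<close>

context dval
begin

text \<open>Column reduction over the valuation ring; the pivot is an entry of least valuation in
  the first row.\<close>

lemma lower_triangular_vertex:
  assumes \<pi>: "\<pi> \<noteq> 0" "v \<pi> = 1" and P: "det P \<noteq> 0" and X: "X \<in> bt_verts v"
  obtains x n where "X = vtx v (P ** mk2 1 0 x (\<pi> powi n))"
proof -
  have normal: "\<exists>c U n x. c \<noteq> 0 \<and> int2 U \<and> det U \<noteq> 0 \<and> v (det U) = 0 \<and>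
      mk2 a b c' d ** U = smat c ** mk2 1 0 x (\<pi> powi n)"
    if "a * d - b * c' \<noteq> 0" "a \<noteq> 0" "vge v b (v a)" for a b c' d
  proof -
    define e where "e = (a * d - b * c') / a\<^sup>2"
    \<comment> \<open>The unit part of the second diagonal entry; dividing by it leaves a pure power
      of \<pi>.\<close>
    define u where "u = e / \<pi> powi (v e)"
    have e: "e \<noteq> 0" using that by (simp add: e_def)
    then have u: "u \<noteq> 0" "v u = 0" using \<pi> by (simp_all add: u_def v_divide v_power_int)
    define U where "U = mk2 1 (- b / (a * u)) 0 (1 / u)"
    have "vge v (- b / (a * u)) 0"
      using vge_divide[of "- b" "v a" "a * u"] that u by (simp add: v_mult)
    then have "int2 U" "det U \<noteq> 0" "v (det U) = 0"
      using u by (auto simp: U_def vge_def v_divide)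
    moreover have "c' * (- b / (a * u)) + d * (1 / u) = a * \<pi> powi (v e)"
    proof -
      have "\<pi> powi (v e) = e / u" using e u \<pi> by (simp add: u_def)
      then show ?thesis using that u by (simp add: e_def field_simps power2_eq_square)
    qed
    then have "mk2 a b c' d ** U = smat a ** mk2 1 0 (c' / a) (\<pi> powi (v e))"
      using that u by (simp add: U_def smat_def)
    ultimately show ?thesis using that by blast
  qed
  obtain g where g: "det g \<noteq> 0" "X = vtx v g" using X bt_verts_cases by metis
  define h where "h = matrix_inv P ** g"
  have gh: "g = P ** h" unfolding h_def by (metis P matrix_inv_mult(1) matrix_mul_assoc matrix_mul_lid)
  then have dh: "det h \<noteq> 0" using g by (auto simp: det_mul)
  obtain a b c d where h: "h = mk2 a b c d" by (rule mat2_cases)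
  have "\<exists>e U n x. e \<noteq> 0 \<and> int2 U \<and> det U \<noteq> 0 \<and> v (det U) = 0 \<and>
      h ** U = smat e ** mk2 1 0 x (\<pi> powi n)"
  proof (cases "a \<noteq> 0 \<and> vge v b (v a)")
    case True
    then show ?thesis using normal[of a d b c] dh h by simp
  next
    case False
    then have "b \<noteq> 0" "vge v a (v b)" using dh h by (auto simp: vge_def)
    moreover have "b * c - a * d \<noteq> 0" using dh h by simp
    ultimately obtain e U n x where U: "e \<noteq> 0" "int2 U" "det U \<noteq> 0" "v (det U) = 0"
      "mk2 b a d c ** U = smat e ** mk2 1 0 x (\<pi> powi n)"
      using normal[of b c a d] by metis
    let ?W = "mk2 0 1 1 (0::'k)"
    have "h ** (?W ** U) = smat e ** mk2 1 0 x (\<pi> powi n)"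
      using U(5) by (simp add: h matrix_mul_assoc)
    moreover have "int2 (?W ** U)" "det (?W ** U) \<noteq> 0" "v (det (?W ** U)) = 0"
      using U by (simp_all add: int2_mult det_mul)
    ultimately show ?thesis using U(1) by blast
  qed
  then obtain e U n x where U: "e \<noteq> 0" "int2 U" "det U \<noteq> 0" "v (det U) = 0"
    "h ** U = smat e ** mk2 1 0 x (\<pi> powi n)" by blast
  have "X = vtx v (P ** (h ** U))"
    using vtx_mult_unit[OF U(2-4), of g] g(2) gh by (simp add: matrix_mul_assoc)
  also have "P ** (h ** U) = smat e ** (P ** mk2 1 0 x (\<pi> powi n))"
    unfolding U(5) by (simp add: matrix_mul_assoc smat_commute[of e P])
  finally show thesis using that vtx_smat_mult[OF U(1)] by simp
qed

text \<open>At the vertex given by x and n the matrix of \<open>A\<close> is integral exactly when x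
  / \<pi>^n is, because l - m is a unit; an integral shear then removes x.\<close>

lemma fix_set_diagonal:
  assumes \<pi>: "\<pi> \<noteq> 0" "v \<pi> = 1" and P: "det P \<noteq> 0" "A ** P = P ** mk2 l 0 0 m"
    and lm: "l * m = 1" "vge v l 0" "vge v m 0" "l \<noteq> m" "v (l - m) = 0"
  shows "fix_set v A = range (\<lambda>n. vtx v (P ** dg \<pi> n))"
proof -
  have frame: "A ** (P ** mk2 1 0 x (\<pi> powi n))
      = P ** mk2 1 0 x (\<pi> powi n) ** mk2 l 0 (x * (m - l) / \<pi> powi n) m" for x n
  proof -
    have "mk2 l 0 0 m ** mk2 1 0 x (\<pi> powi n)
      = mk2 1 0 x (\<pi> powi n) ** mk2 l 0 (x * (m - l) / \<pi> powi n) m"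
      using \<pi> by (simp add: field_simps)
    then show ?thesis unfolding matrix_mul_assoc P(2) by (simp only: matrix_mul_assoc[symmetric])
  qed
  have fix_iff: "bt_act A (vtx v (P ** mk2 1 0 x (\<pi> powi n))) = vtx v (P ** mk2 1 0 x (\<pi> powi n))
     \<longleftrightarrow> vge v (x / \<pi> powi n) 0" for x n
  proof -
    have d: "det (P ** mk2 1 0 x (\<pi> powi n)) \<noteq> 0" using P \<pi> by (simp add: det_mul)
    have "m - l \<noteq> 0" "v (m - l) = 0"
      using lm v_uminus[of "l - m"] by auto
    then have "vge v ((m - l) * (x / \<pi> powi n)) 0 \<longleftrightarrow> vge v (x / \<pi> powi n) 0"
      using vge_mult_cancel[of "m - l" "x / \<pi> powi n" 0] by simp
    moreover have "(m - l) * (x / \<pi> powi n) = x * (m - l) / \<pi> powi n" by simp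
    ultimately have "vge v (x * (m - l) / \<pi> powi n) 0 \<longleftrightarrow> vge v (x / \<pi> powi n) 0"
      by metis
    then show ?thesis using bt_act_fix_iff[OF d _ frame] lm by simp
  qed
  show ?thesis
  proof
    show "range (\<lambda>n. vtx v (P ** dg \<pi> n)) \<subseteq> fix_set v A"
      using fix_iff[of 0] P \<pi> by (auto simp: fix_set_def dg_def det_mul)
    show "fix_set v A \<subseteq> range (\<lambda>n. vtx v (P ** dg \<pi> n))"
    proof
      fix X assume X: "X \<in> fix_set v A"
      obtain x n where Xe: "X = vtx v (P ** mk2 1 0 x (\<pi> powi n))"
        using lower_triangular_vertex[OF \<pi> P(1), of X] X by (auto simp: fix_set_def)
      have "vge v (x / \<pi> powi n) 0" using X Xe fix_iff by (simp add: fix_set_def)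
      then have U: "int2 (mk2 1 0 (x / \<pi> powi n) 1)" by simp
      have "P ** mk2 1 0 x (\<pi> powi n) = P ** dg \<pi> n ** mk2 1 0 (x / \<pi> powi n) 1"
        using \<pi> by (simp add: dg_def flip: matrix_mul_assoc)
      then have "X = vtx v (P ** dg \<pi> n)" using Xe vtx_mult_unit[OF U] by simp
      then show "X \<in> range (\<lambda>n. vtx v (P ** dg \<pi> n))" by blast
    qed
  qed
qed

text \<open>Displacement is minimal exactly where all entries of the matrix of \<open>B\<close> have
  valuation at least v(tr B). Conjugation by \<open>dg \<pi> n\<close> raises v(b) by n and lowers
  v(c) by n.\<close>

lemma axis_diagonal_iff:
  assumes \<pi>: "\<pi> \<noteq> 0" "v \<pi> = 1" and P: "det P \<noteq> 0" "B ** P = P ** mk2 a b c d"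
    and B: "det B = 1" "tr2 B \<noteq> 0" "v (tr2 B) < 0" and bc: "b \<noteq> 0" "c \<noteq> 0"
  shows "vtx v (P ** dg \<pi> n) \<in> axis v B \<longleftrightarrow>
    vge v a (v (tr2 B)) \<and> vge v d (v (tr2 B)) \<and> v (tr2 B) \<le> v b + n \<and> v (tr2 B) \<le> v c - n"
proof -
  let ?M = "mk2 a (b * \<pi> powi n) (c * \<pi> powi (- n)) d"
  have tr: "tr2 B = a + d" and det: "a * d - b * c = 1"
    using tr2_frame[OF P] det_frame[OF P] B by simp_all
  have "mk2 a b c d ** dg \<pi> n = dg \<pi> n ** ?M"
    using \<pi> by (simp add: dg_def power_int_minus)
  then have frame: "B ** (P ** dg \<pi> n) = P ** dg \<pi> n ** ?M"
    unfolding matrix_mul_assoc P(2) by (simp only: matrix_mul_assoc[symmetric])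
  have "\<pi> powi n * \<pi> powi (- n) = 1" using \<pi> by (simp add: power_int_minus)
  then have "b * \<pi> powi n * (c * \<pi> powi (- n)) = b * c"
    by (metis mult.assoc mult.left_commute mult.right_neutral)
  then have dM: "det ?M = 1" using det by (simp only: det_mk2)
  then have M0: "?M \<noteq> 0" by (metis det2_0 zero_neq_one)
  have dP: "det (P ** dg \<pi> n) \<noteq> 0" using P \<pi> by (simp add: det_mul det_dg)
  have le: "mval ?M \<le> v (tr2 B)" using mval_le_tr[of ?M] B tr by simp
  have "vtx v (P ** dg \<pi> n) \<in> axis v B \<longleftrightarrow> nat (- 2 * mval ?M) = nat (- 2 * v (tr2 B))"
    using dP bt_dist_move[OF dP dM frame] trans_len_hyperbolic[OF B] by (simp add: axis_def)
  also have "\<dots> \<longleftrightarrow> v (tr2 B) \<le> mval ?M" using le B by auto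
  also have "\<dots> \<longleftrightarrow> vge v a (v (tr2 B)) \<and> vge v d (v (tr2 B)) \<and> v (tr2 B) \<le> v b + n \<and> v (tr2 B) \<le> v c - n"
    unfolding mval_mk2[OF M0] using bc \<pi> by (auto simp: vge_def v_mult v_power_int)
  finally show ?thesis .
qed

end

section \<open>Diagonalisable A in a discrete non-elementary group\<close>

context discrete_setting
begin

text \<open>Since l - m = m (l - 1)(l + 1) is a unit, l avoids the residues 0, 1 and -1, which
  exhaust a field of two or three elements.\<close>

lemma residue_not_2_3:
  assumes lm: "l * m = 1" "vge v l 0" "vge v m 0" "l \<noteq> m" "v (l - m) = 0"
  shows "\<not> (is_Qp v p \<and> (p = 2 \<or> p = 3))"
proof
  assume Q: "is_Qp v p \<and> (p = 2 \<or> p = 3)"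
  then have card: "card (residue_field v) = p" by (simp add: is_Qp_def)
  have nlm: "\<not> vge v (l - m) 1" using lm by (simp add: vge_def)
  have l0: "\<not> vge v l 1"
  proof
    assume "vge v l 1"
    then have "vge v (l * m) 1" using lm by (intro vge_mult_right)
    then show False using lm by (simp add: vge_def)
  qed
  have sq: "l - m = m * ((l - 1) * (l + 1))"
    using lm(1) by (simp add: algebra_simps)
  have l1: "\<not> vge v (l - 1) 1"
    using nlm vge_mult_left[OF lm(3) vge_mult_right[of "l - 1" 1 "l + 1"]] vge_add[OF lm(2) vge_1] unfolding sq
    by auto
  have l2: "\<not> vge v (l + 1) 1"
    using nlm vge_mult_left[OF lm(3) vge_mult_left[of "l - 1" "l + 1" 1]] vge_diff[OF lm(2) vge_1] unfolding sq
    by auto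
  have l1': "\<not> vge v (1 - l) 1" using l1 vge_uminus[of "l - 1" 1] by simp
  have l2': "\<not> vge v (- 1 - l) 1" using l2 vge_uminus[of "- 1 - l" 1] by (simp add: add.commute)
  have one: "\<not> vge v 1 1" by (simp add: vge_def)
  have ne: "l \<noteq> 0" "l \<noteq> 1" "l \<noteq> -1" using l0 l1 l2 by auto
  show False
  proof (cases "p = 2")
    case True
    have "card {0, 1, l} \<le> card (residue_field v)"
      by (rule residue_classes_le[OF fin]) (use lm l0 l1 l1' one in \<open>auto simp: val_ring_def\<close>)
    then show False using card True ne by simp
  next
    case False
    then have p3: "p = 3" using Q by blast
    have two: "(2::'k) \<noteq> 0" "v 2 = 0" using v_coprime[OF vp, of 2] p3 by simp_all
    then have "\<not> vge v 2 1" by (simp add: vge_def)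
    have "(1::'k) \<noteq> -1" using two(1) by (metis one_add_one add.right_inverse)
    have "card {0, 1, -1, l} \<le> card (residue_field v)"
      by (intro residue_classes_le[OF fin])
        (use \<open>\<not> vge v 2 1\<close> lm l0 l1 l1' l2 l2' one vge_uminus[of 2 1] in \<open>auto simp: val_ring_def\<close>)
    then show False using card p3 ne \<open>(1::'k) \<noteq> -1\<close> by simp
  qed
qed

text \<open>The residue field is finite, so some l^k is 1 modulo \<pi>; then A^k has trace 2 modulo
  \<pi> and finite order by discreteness.\<close>

lemma diagonal_finite_order:
  assumes P: "det P \<noteq> 0" "A ** P = P ** mk2 l 0 0 m"
    and lm: "l * m = 1" "vge v l 0" "vge v m 0"
  shows "has_finite_order A"
proof -
  obtain i j :: nat where ij: "i < j" "vge v (l ^ i - l ^ j) 1"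
    using residue_pigeonhole[OF fin lm(2)] by metis
  define k where "k = j - i"
  have k: "k > 0" "j = i + k" using ij by (auto simp: k_def)
  have pw: "l ^ n * m ^ n = 1" for n using lm(1) by (metis power_mult_distrib power_one)
  have "m ^ i * (l ^ i - l ^ j) = 1 - l ^ k"
    using pw[of i] by (simp add: k power_add algebra_simps)
  then have 1: "vge v (1 - l ^ k) 1" using vge_mult_left[OF vge_power0[OF lm(3)] ij(2)] by metis
  have "m ^ k - 1 = m ^ k * (1 - l ^ k)" using pw[of k] by (simp add: algebra_simps)
  then have 2: "vge v (m ^ k - 1) 1" using vge_mult_left[OF vge_power0[OF lm(3)] 1] by metis
  have "mpow (mk2 l 0 0 m) n = mk2 (l ^ n) 0 0 (m ^ n)" for n
    by (induction n) (simp_all add: mat_1_mk2 mpow_Suc)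
  then have "tr2 (mpow A k) = l ^ k + m ^ k" using tr2_frame[OF P(1) mpow_frame[OF P(2)], of k] by simp
  then have "tr2 (mpow A k) - 2 = m ^ k - 1 - (1 - l ^ k)" by simp
  moreover have "vge v (m ^ k - 1 - (1 - l ^ k)) 1" using 2 1 by (rule vge_diff)
  ultimately have "vge v (tr2 (mpow A k) - 2) 1" by (simp only:)
  then obtain K where "mpow (mpow A k) (p ^ K) = mat 1"
    using unipotent_finite_order[OF vp prime_p(2) A B disc mpow_gen2[OF gen_A]] by metis
  then have "mpow A (k * p ^ K) = mat 1" by (simp add: mpow_mult)
  then show ?thesis unfolding has_finite_order_def using k prime_p(2)
    by (intro exI[of _ "k * p ^ K"]) simp
qed

text \<open>In the eigenbasis of A both sides amount to v(b c) = 0. With s = v(tr B) < 0, the axis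
  of B, if it meets the line fixed by A, does so for n from s - v(b) to v(c) - s, and this length is
  v(b c) plus the translation length -2s.\<close>

lemma split_case:
  assumes t: "(tr2 A)\<^sup>2 - 4 \<noteq> 0" "v ((tr2 A)\<^sup>2 - 4) = 0" "vge v (tr2 A) 0"
    and r: "vge v r 0" "vge v (r\<^sup>2 - tr2 A * r + 1) 1"
  shows "vge v (tr2 (comm2 A B) - 2) 0 \<longleftrightarrow>
     (elliptic v A \<and> has_finite_order A \<and> hyperbolic v B \<and>
      finite (fix_set v A \<inter> axis v B) \<and>
      (\<exists>X\<in>fix_set v A \<inter> axis v B. \<exists>Y\<in>fix_set v A \<inter> axis v B. bt_dist v X Y = trans_len v B) \<and>
      (\<forall>X\<in>fix_set v A \<inter> axis v B. \<forall>Y\<in>fix_set v A \<inter> axis v B. bt_dist v X Y \<le> trans_len v B))"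
    (is "?L \<longleftrightarrow> ?R")
proof -
  have ru: "2 * r - tr2 A \<noteq> 0" "v (2 * r - tr2 A) = 0"
  proof -
    \<comment> \<open>f'(r)^2 is the discriminant plus 4 f(r), so f'(r) is a unit and r lifts to a
      root.\<close>
    have e: "(2 * r - tr2 A)\<^sup>2 = (tr2 A)\<^sup>2 - 4 + 4 * (r\<^sup>2 - tr2 A * r + 1)"
      by (simp add: power2_eq_square algebra_simps)
    have "vge v (4 * (r\<^sup>2 - tr2 A * r + 1)) (v ((tr2 A)\<^sup>2 - 4) + 1)"
      using t(2) vge_mult_left[OF vge_numeral r(2)] by simp
    from v_add_less[OF t(1) this] have "(2 * r - tr2 A)\<^sup>2 \<noteq> 0" "v ((2 * r - tr2 A)\<^sup>2) = 0"
      unfolding e t(2) by simp_all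
    then show "2 * r - tr2 A \<noteq> 0" "v (2 * r - tr2 A) = 0" by (auto simp: v_power)
  qed
  obtain l where l: "vge v l 0" "l\<^sup>2 - tr2 A * l + 1 = 0"
    using hensel_quadratic[OF compl t(3) vge_1 r ru] by metis
  define m where "m = tr2 A - l"
  have lm1: "l * m = 1" using l(2) by (simp add: m_def power2_eq_square algebra_simps)
  have sqlm: "(l - m)\<^sup>2 = (tr2 A)\<^sup>2 - 4"
  proof -
    have "(l - m)\<^sup>2 = (l + m)\<^sup>2 - 4 * (l * m)" by (simp add: power2_eq_square algebra_simps)
    then show ?thesis using lm1 by (simp add: m_def)
  qed
  then have "l \<noteq> m" using t(1) by auto
  then have lm_ne: "l \<noteq> m" "v (l - m) = 0" using t(2) v_power[of "l - m" 2] sqlm by auto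
  have im: "vge v m 0" unfolding m_def using t(3) l(1) by (rule vge_diff)
  note lm = lm1 l(1) im lm_ne
  obtain P where P: "det P \<noteq> 0" "A ** P = P ** mk2 l 0 0 m"
    using diagonal_frame[OF A lm1 _ lm_ne(1)] m_def by auto
  obtain B' where B': "B ** P = P ** B'" "det B' = 1" using frame_exists[OF P(1)] B by metis
  obtain a b c d where Be: "B' = mk2 a b c d" by (rule mat2_cases)
  have BP: "B ** P = P ** mk2 a b c d" and det: "a * d - b * c = 1" using B' Be by simp_all
  have trB: "tr2 B = a + d" using tr2_frame[OF P(1) BP] by simp
  have gam: "tr2 (comm2 A B) - 2 = - ((l - m)\<^sup>2 * (b * c))"
    unfolding tr2_comm2[OF A B] det_commutator_frame[OF P BP] det_commutator_diagonal by simp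
  have gam_iff: "vge v (tr2 (comm2 A B) - 2) n \<longleftrightarrow> vge v (b * c) n" for n
    unfolding gam using lm_ne by (simp add: vge_mult_cancel v_power)
  have b0: "b \<noteq> 0"
  proof
    assume "b = 0"
    \<comment> \<open>With b = 0 the second basis vector is a common eigenvector; swapping the
      columns puts it first.\<close>
    let ?W = "mk2 0 1 1 (0::'k)"
    have "mk2 l 0 0 m ** ?W = ?W ** mk2 m 0 0 l" "mk2 a b c d ** ?W = ?W ** mk2 d c 0 a"
      using \<open>b = 0\<close> by simp_all
    then have "A ** (P ** ?W) = P ** ?W ** mk2 m 0 0 l" "B ** (P ** ?W) = P ** ?W ** mk2 d c 0 a"
      unfolding matrix_mul_assoc P(2) BP by (simp_all only: matrix_mul_assoc[symmetric])
    moreover have "det (P ** ?W) \<noteq> 0" using P by (simp add: det_mul)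
    ultimately show False using elementary_eigenvector[OF A B] nonel by blast
  qed
  have c0: "c \<noteq> 0" using elementary_eigenvector[OF A B P] BP nonel by blast
  have not_pos: "\<not> vge v (b * c) 1"
  proof
    assume bc1: "vge v (b * c) 1"
    \<comment> \<open>For v(b c) > 0 the commutator of A with its conjugate by B has trace 2 modulo
      \<pi>. It is thus trivial, which would force b c = -1.\<close>
    define A' where "A' = B ** A ** matrix_inv B"
    let ?D = "mk2 l 0 0 m" and ?I = "mk2 d (- b) (- c) a"
    have BI: "matrix_inv B ** P = P ** ?I"
    proof -
      have "mk2 a b c d ** ?I = mat 1" using det by (simp add: mat_1_mk2 algebra_simps)
      then have "B ** (P ** ?I) = P"
        unfolding matrix_mul_assoc BP by (simp only: matrix_mul_assoc[symmetric] matrix_mul_rid)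
      moreover have "matrix_inv B ** B = mat 1" using B by (simp add: matrix_inv_mult)
      ultimately show ?thesis by (metis matrix_mul_assoc matrix_mul_lid)
    qed
    have "A' ** P = B ** (A ** (matrix_inv B ** P))" by (simp add: A'_def matrix_mul_assoc)
    also have "\<dots> = P ** (mk2 a b c d ** ?D ** ?I)"
      unfolding BI unfolding matrix_mul_assoc P(2) BP by (simp only: matrix_mul_assoc BP)
    finally have A'P: "A' ** P = P ** (mk2 a b c d ** ?D ** ?I)" .
    have A'G: "A' \<in> gen2 A B" unfolding A'_def by (intro gen2.intros)
    have dA': "det A' = 1" using det_gen2[OF A B A'G] .
    define g where "g = comm2 A A'"
    have gG: "g \<in> gen2 A B" unfolding g_def comm2_def by (intro gen2.intros A'G)
    \<comment> \<open>The off-diagonal entries of the conjugate are -(l - m) a b and (l - m) c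
      d.\<close>
    have tg: "tr2 g - 2 = (l - m) ^ 4 * ((1 + b * c) * (b * c))"
    proof -
      have "tr2 g - 2 = (l - m) ^ 4 * ((a * d) * (b * c))"
        unfolding g_def tr2_comm2[OF A dA'] det_commutator_frame[OF P A'P] det_commutator_diagonal
        unfolding mk2_mult mk2_nth by algebra
      moreover have "a * d = 1 + b * c" using det by (simp add: algebra_simps)
      ultimately show ?thesis by (simp only:)
    qed
    have bc0: "vge v (b * c) 0" using bc1 by (rule vge_mono) simp
    have ilm: "vge v (l - m) 0" by (rule vge_diff[OF l(1) im])
    have "vge v (tr2 g - 2) 1" unfolding tg
      by (rule vge_mult_left[OF vge_power0[OF ilm] vge_mult_left[OF vge_add[OF vge_1 bc0] bc1]])
    then have "g = mat 1" using unipotent_trivial[OF residue_not_2_3[OF lm] gG] by blast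
    then have "(l - m) ^ 4 * ((1 + b * c) * (b * c)) = 0" using tg by (simp add: mat_1_mk2)
    then have "1 + b * c = 0" using lm_ne b0 c0 by simp
    then have "b * c = -1" by (simp add: add_eq_0_iff)
    then show False using bc1 by (simp add: vge_def)
  qed
  obtain \<pi> where \<pi>: "\<pi> \<noteq> 0" "v \<pi> = 1" by (rule uniformizer)
  define X where "X n = vtx v (P ** dg \<pi> n)" for n
  have fixA: "fix_set v A = range X"
    unfolding X_def using fix_set_diagonal[OF \<pi> P lm] .
  have dX: "bt_dist v (X i) (X j) = nat \<bar>i - j\<bar>" for i j
    unfolding X_def by (rule bt_dist_dg[OF \<pi> P(1)])
  define s where "s = v (tr2 B)"
  have axB: "X n \<in> axis v B \<longleftrightarrow> vge v a s \<and> vge v d s \<and> s - v b \<le> n \<and> n \<le> v c - s"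
    if "tr2 B \<noteq> 0" "s < 0" for n
  proof -
    have "v (tr2 B) < 0" using that(2) by (simp add: s_def)
    from axis_diagonal_iff[OF \<pi> P(1) BP B that(1) this b0 c0, of n]
    show ?thesis unfolding X_def s_def by (simp add: algebra_simps)
  qed
  have tl: "trans_len v B = nat (- 2 * s)" if "tr2 B \<noteq> 0" "s < 0"
    using trans_len_hyperbolic[OF B] that by (simp add: s_def)
  have hy: "hyperbolic v B \<longleftrightarrow> tr2 B \<noteq> 0 \<and> s < 0" unfolding s_def by (rule hyperbolic_iff[OF B])
  have vbc: "v (b * c) = v b + v c" using b0 c0 by (rule v_mult)
  show ?thesis
  proof
    assume ?L
    then have bc0: "vge v (b * c) 0" using gam_iff by blast
    have "a * d = 1 + b * c" using det by (simp add: algebra_simps)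
    moreover have "vge v (1 + b * c) 0" using vge_1 bc0 by (rule vge_add)
    ultimately have ad0: "vge v (a * d) 0" by (simp only:)
    have vb0: "v b + v c = 0" using bc0 not_pos b0 c0 vbc by (auto simp: vge_def)
    \<comment> \<open>If v(x) < n \<le> 0, integrality of x y makes v(y) positive, so that v(x + y)
      = v(x) < n.\<close>
    have sum: "vge v x n \<and> vge v y n" if "vge v (x + y) n" "n \<le> 0" "vge v (x * y) 0" for x y n
    proof -
      have "vge v x n" if "vge v (x + y) n" "vge v (x * y) 0" for x y
      proof (rule ccontr)
        assume x: "\<not> vge v x n"
        then have x': "x \<noteq> 0" "v x < n" by (auto simp: not_vge)
        have "vge v y (v x + 1)"
          using that(2) x' \<open>n \<le> 0\<close> unfolding vge_mult_cancel[OF x'(1)] by (rule_tac vge_mono) auto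
        from v_add_less[OF x'(1) this] show False using that(1) x' by (simp add: vge_def)
      qed
      from this[of x y] this[of y x] show ?thesis using that by (simp add: add.commute mult.commute)
    qed
    have hyp': "tr2 B \<noteq> 0 \<and> s < 0"
    proof (rule ccontr)
      assume "\<not> (tr2 B \<noteq> 0 \<and> s < 0)"
      then have "vge v (a + d) 0" unfolding trB[symmetric] s_def by (auto simp: vge_def)
      then have ad: "vge v a 0" "vge v d 0" using sum[of a d 0] ad0 by auto
      \<comment> \<open>At this vertex both off-diagonal entries of B become units, as v(b) + v(c) =
        0; A and B would both fix it.\<close>
      define n where "n = - v b"
      have "mk2 a b c d ** dg \<pi> n = dg \<pi> n ** mk2 a (b * \<pi> powi n) (c * \<pi> powi (- n)) d"
        using \<pi> by (simp add: dg_def power_int_minus)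
      moreover have "mk2 l 0 0 m ** dg \<pi> n = dg \<pi> n ** mk2 l 0 0 m"
        by (simp add: dg_def)
      ultimately have "B ** (P ** dg \<pi> n) = P ** dg \<pi> n ** mk2 a (b * \<pi> powi n) (c * \<pi> powi (- n)) d"
        "A ** (P ** dg \<pi> n) = P ** dg \<pi> n ** mk2 l 0 0 m"
        unfolding matrix_mul_assoc P(2) BP by (simp_all only: matrix_mul_assoc[symmetric])
      moreover have "int2 (mk2 a (b * \<pi> powi n) (c * \<pi> powi (- n)) d)"
        using ad b0 c0 \<pi> vb0 by (auto simp: vge_def n_def v_mult v_power_int)
      moreover have "int2 (mk2 l 0 0 m)" using lm by simp
      moreover have "det (P ** dg \<pi> n) \<noteq> 0" using P \<pi> by (simp add: det_mul det_dg)
      ultimately show False using elementary_vertex[OF A B] nonel by blast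
    qed
    have "vge v (a + d) s" unfolding trB[symmetric] s_def by simp
    then have ads: "vge v a s" "vge v d s" using sum[of a d s] ad0 hyp' by auto
    have tl': "trans_len v B = nat (- 2 * s)" using tl hyp' by blast
    have mem: "X n \<in> axis v B \<longleftrightarrow> n \<in> {s - v b..v c - s}" for n
      using axB[of n] hyp' ads by simp
    have inter: "fix_set v A \<inter> axis v B = X ` {s - v b..v c - s}"
      unfolding fixA by (auto simp only: mem)
    have len: "v c - s - (s - v b) = - 2 * s" using vb0 by simp
    have "s - v b \<le> v c - s" using hyp' vb0 by linarith
    then have "X (s - v b) \<in> fix_set v A \<inter> axis v B" "X (v c - s) \<in> fix_set v A \<inter> axis v B"
      unfolding inter by (blast intro: order_refl atLeastAtMost_iff[THEN iffD2])+
    moreover have "bt_dist v (X (s - v b)) (X (v c - s)) = trans_len v B"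
      unfolding dX tl' using hyp' len by linarith
    moreover have "\<forall>Y\<in>fix_set v A \<inter> axis v B. \<forall>Z\<in>fix_set v A \<inter> axis v B. bt_dist v Y Z \<le> trans_len v B"
      unfolding inter tl' ball_simps dX using len by (intro ballI nat_mono) (simp only: atLeastAtMost_iff, linarith)
    moreover have "finite (fix_set v A \<inter> axis v B)" unfolding inter by simp
    moreover have "elliptic v A" unfolding elliptic_def fixA by simp
    moreover have "has_finite_order A" using diagonal_finite_order[OF P lm1 l(1) im] .
    ultimately show ?R using hy hyp' by blast
  next
    assume R: ?R
    then have hyp': "tr2 B \<noteq> 0" "s < 0" using hy by auto
    note axB = axB[OF hyp'] and tl = tl[OF hyp']
    obtain i j where ij: "X i \<in> axis v B" "X j \<in> axis v B" "bt_dist v (X i) (X j) = trans_len v B"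
      using R unfolding fixA by blast
    have i: "vge v a s" "vge v d s" "s - v b \<le> i" "i \<le> v c - s" using ij(1) unfolding axB by blast+
    have j: "s - v b \<le> j" "j \<le> v c - s" using ij(2) unfolding axB by blast+
    \<comment> \<open>Both ends of the interval lie on the axis, so the bound on distances gives v(b
      c) \<le> 0. The pair \<open>i\<close>, \<open>j\<close> at distance -2s inside the interval
      gives the reverse inequality.\<close>
    have "X (s - v b) \<in> axis v B" "X (v c - s) \<in> axis v B" unfolding axB using i by simp_all
    then have "bt_dist v (X (s - v b)) (X (v c - s)) \<le> trans_len v B" using R unfolding fixA by blast
    then have "v b + v c \<le> 0" unfolding dX tl using hyp' by linarith
    moreover have "0 \<le> v b + v c" using ij(3) i j hyp' unfolding dX tl by linarith
    ultimately show ?L unfolding gam_iff using vbc by (simp add: vge_def)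
  qed
qed

end

text \<open>The axis is a line and the fixed point set is convex, so they meet in a path; its length
  is the largest distance between two of its vertices.\<close>

theorem theorem1p2:
  fixes v :: "'k::field \<Rightarrow> int" and p :: nat and A B :: "'k^2^2"
  assumes K: "nonarch_local_field v"
    and p: "residue_char v p"
    and AB: "A \<in> SL2" "B \<in> SL2"
    and disc: "discrete_subgroup v (gen2 A B)"
    and nonel: "\<not> elementary v (gen2 A B)"
    and hyp: "is_Qp v p \<or> (\<forall>g\<in>gen2 A B. \<not> has_order g p)"
  shows "min (vinf v ((tr2 A)\<^sup>2 - 4)) (vinf v (tr2 (comm2 A B) - 2)) \<le> 0 \<and>
         (min (vinf v ((tr2 A)\<^sup>2 - 4)) (vinf v (tr2 (comm2 A B) - 2)) = 0 \<longleftrightarrow>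
           (elliptic v A \<and> has_finite_order A \<and> hyperbolic v B \<and>
            finite (fix_set v A \<inter> axis v B) \<and>
            (\<exists>X\<in>fix_set v A \<inter> axis v B. \<exists>Y\<in>fix_set v A \<inter> axis v B.
                bt_dist v X Y = trans_len v B) \<and>
            (\<forall>X\<in>fix_set v A \<inter> axis v B. \<forall>Y\<in>fix_set v A \<inter> axis v B.
                bt_dist v X Y \<le> trans_len v B)))"
    (is "min ?a ?c \<le> 0 \<and> (min ?a ?c = 0 \<longleftrightarrow> ?R)")
proof -
  have A: "det A = 1" and B: "det B = 1" using AB by (auto simp: SL2_def)
  interpret discrete_setting v p A B
    using K p A B disc nonel hyp by unfold_locales (auto simp: nonarch_local_field_def)
  have vinf_neg: "vinf v x < 0 \<longleftrightarrow> \<not> vge v x 0" and vinf_0: "vinf v x = 0 \<longleftrightarrow> x \<noteq> 0 \<and> v x = 0" for x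
    by (auto simp: vinf_def vge_def)
  let ?t = "tr2 A"
  show ?thesis
  proof (cases "vge v ?t 0")
    case False
    then have t: "?t \<noteq> 0" "v ?t < 0" by (simp_all add: not_vge)
    \<comment> \<open>4 is integral while v(t^2) = 2 v(t) < 0, so t^2 dominates in t^2 - 4.\<close>
    have "vge v (- 4) (v (?t\<^sup>2) + 1)" by (rule vge_mono[of _ 0]) (use t in \<open>auto simp: v_power\<close>)
    from v_add_less[OF _ this] have "\<not> vge v (?t\<^sup>2 - 4) 0" using t by (simp add: vge_def v_power)
    then have "min ?a ?c < 0" using vinf_neg by (simp add: min_less_iff_disj)
    moreover have "\<not> elliptic v A" using elliptic_imp_integral_trace[OF A] False by blast
    ultimately show ?thesis by auto
  next
    case t: True
    have t4: "vge v (?t\<^sup>2 - 4) 0" using t by (intro vge_diff vge_power0 vge_numeral)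
    show ?thesis
    proof (cases "\<exists>r. vge v r 0 \<and> vge v (r\<^sup>2 - ?t * r + 1) 2")
      case False
      then have an: "\<And>l. vge v l 0 \<Longrightarrow> \<not> vge v (l\<^sup>2 - ?t * l + 1) 2" by blast
      have "\<not> vge v (tr2 (comm2 A B) - 2) 0" using anisotropic_case[OF A B t an] nonel by blast
      then have "min ?a ?c < 0" using vinf_neg by (simp add: min_less_iff_disj)
      moreover have "\<not> ?R"
      proof
        assume R: ?R
        then have s: "tr2 B \<noteq> 0" "v (tr2 B) < 0" using hyperbolic_iff[OF B] by auto
        obtain X Y where XY: "X \<in> fix_set v A" "Y \<in> fix_set v A" "bt_dist v X Y = trans_len v B"
          using R by blast
        obtain l where l: "vge v l 0" "vge v (l\<^sup>2 - ?t * l + 1) (int (bt_dist v X Y))"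
          using fix_dist_imp_approx_root[OF A XY(1,2)] by metis
        \<comment> \<open>The translation length is even and positive; two fixed vertices of A at
          this distance would give a root modulo \<pi>^2.\<close>
        have "2 \<le> int (bt_dist v X Y)" unfolding XY(3) trans_len_hyperbolic[OF B s] using s by simp
        then show False using an[OF l(1)] vge_mono[OF l(2)] by blast
      qed
      ultimately show ?thesis by auto
    next
      case True
      then obtain r where r: "vge v r 0" "vge v (r\<^sup>2 - ?t * r + 1) 2" by blast
      have "\<not> vge v (?t\<^sup>2 - 4) 1" using unipotent_case r by blast
      then have t0: "?t\<^sup>2 - 4 \<noteq> 0" "v (?t\<^sup>2 - 4) = 0" using t4 by (auto simp: vge_def)
      have "vge v (r\<^sup>2 - ?t * r + 1) 1" using r(2) by (rule vge_mono) simp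
      from split_case[OF t0 t r(1) this]
      have "vge v (tr2 (comm2 A B) - 2) 0 \<longleftrightarrow> ?R" .
      moreover have "?a = 0" using t0 vinf_0 by blast
      \<comment> \<open>The first valuation is 0 here, so only the sign of the second one
        matters.\<close>
      moreover have "min 0 ?c = 0 \<longleftrightarrow> vge v (tr2 (comm2 A B) - 2) 0"
        using vinf_neg[of "tr2 (comm2 A B) - 2"] by (auto simp: min_def not_less)
      ultimately show ?thesis by simp
    qed
  qed
qed

end
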